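(* Let $T^*>0$, let $p\ge1$ be an integer, and suppose $s\ge0$ if $p=1$ and $s>\tfrac12$ if $p>1$. For every $U_0=(u_0,v_0)\in X^s$ and $f\in L^1(0,T^*;H^{s-2}(\mathbb{T}))$ there exists $T\in(0,T^*]$, depending only on $\|U_0\|_{X^s}$ and $\|f\|_{L^1(0,T^*;H^{s-2}(\mathbb{T}))}$, such that the problem $$\partial_t u-\partial_x^2\partial_t u+u^p\partial_x u-\partial_x v=f,\qquad \partial_t v-\partial_x u=0,\qquad u(\cdot,0)=u_0,\ v(\cdot,0)=v_0,$$ has a unique (mild) solution $(u,v)\in C([0,T];X^s)$. Moreover, for every $0<T_1<T$ there is a neighborhood $\mathbb{V}$ of $(u_0,v_0,f)$ in $X^s\times L^1(0,T^*;H^{s-2}(\mathbb{T}))$ such that for every $(\tilde u_0,\tilde v_0,\tilde f)\in\mathbb{V}$ the corresponding mild solution $(\tilde u,\tilde v)$ exists in $C([0,T_1];X^s)$, and the map $(\tilde u_0,\tilde v_0,\tilde f)\mapsto(\tilde u,\tilde v)$ is Lipschitz from $\mathbb{V}$ into $C([0,T_1];X^s)$.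
   Context: $\mathbb{T}=\mathbb{R}/2\pi\mathbb{Z}$; $H^s(\mathbb{T})$ is the periodic Sobolev space of real-valued functions, norm $\|u\|_{H^s}^2=\sum_k(1+k^2)^s|\hat u_k|^2$; $X^s=H^s(\mathbb{T})\times H^{s-1}(\mathbb{T})$ with $\|(u,v)\|_{X^s}^2=\|u\|_{H^s}^2+\|v\|_{H^{s-1}}^2$. $(I-\partial_x^2)^{-1}$ is the Fourier multiplier $(1+k^2)^{-1}$; $A(u,v)=((I-\partial_x^2)^{-1}\partial_xv,\partial_xu)$; $G(u,v)=((I-\partial_x^2)^{-1}\partial_x(\tfrac{1}{p+1}u^{p+1}),0)$. A mild solution on $[0,T]$ is $U=(u,v)\in C([0,T];X^s)$ satisfying $U(t)=e^{tA}U_0-\int_0^te^{(t-\tau)A}G(U(\tau))d\tau+\int_0^te^{(t-\tau)A}((I-\partial_x^2)^{-1}f(\tau),0)d\tau$ for $t\in[0,T]$. *)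

theory Defs
  imports "HOL-Analysis.Analysis"
begin

text \<open>A periodic (real-valued) distribution on the torus is represented by its
Fourier coefficient sequence c :: int => complex, u = sum_k c_k e^{ikx},
c_k = (1/(2 pi)) int u e^{-ikx}.  Real-valuedness is c(-k) = cnj(c k).\<close>

type_synonym coeffs = "int \<Rightarrow> complex"
type_synonym state = "coeffs \<times> coeffs"

definition Hs :: "real \<Rightarrow> coeffs set" where
  "Hs s = {c. (\<forall>k. c (-k) = cnj (c k)) \<and>
              (\<lambda>k. (1 + (of_int k)\<^sup>2) powr s * (cmod (c k))\<^sup>2) summable_on (UNIV :: int set)}"

definition Hnorm :: "real \<Rightarrow> coeffs \<Rightarrow> real" where
  "Hnorm s c = sqrt (infsum (\<lambda>k::int. (1 + (of_int k)\<^sup>2) powr s * (cmod (c k))\<^sup>2) UNIV)"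

definition Xs :: "real \<Rightarrow> state set" where
  "Xs s = {U. fst U \<in> Hs s \<and> snd U \<in> Hs (s - 1)}"

definition Xnorm :: "real \<Rightarrow> state \<Rightarrow> real" where
  "Xnorm s U = sqrt ((Hnorm s (fst U))\<^sup>2 + (Hnorm (s - 1) (snd U))\<^sup>2)"

definition stdiff :: "state \<Rightarrow> state \<Rightarrow> state" where
  "stdiff U V = ((\<lambda>k. fst U k - fst V k), (\<lambda>k. snd U k - snd V k))"

definition fdiff :: "(real \<Rightarrow> coeffs) \<Rightarrow> (real \<Rightarrow> coeffs) \<Rightarrow> (real \<Rightarrow> coeffs)" where
  "fdiff f g = (\<lambda>t k. f t k - g t k)"

text \<open>f in L^1(0,Ts; H^{s-2}(T)) (a representative with values in H^{s-2};
coordinatewise measurability = strong measurability by Pettis, H^{s-2} separable).\<close>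
definition L1 :: "real \<Rightarrow> real \<Rightarrow> (real \<Rightarrow> coeffs) \<Rightarrow> bool" where
  "L1 s Ts f \<longleftrightarrow> (\<forall>t\<in>{0..Ts}. f t \<in> Hs (s - 2)) \<and>
     (\<forall>k. set_borel_measurable lborel {0..Ts} (\<lambda>t. f t k)) \<and>
     set_integrable lborel {0..Ts} (\<lambda>t. Hnorm (s - 2) (f t))"

definition L1norm :: "real \<Rightarrow> real \<Rightarrow> (real \<Rightarrow> coeffs) \<Rightarrow> real" where
  "L1norm s Ts f = (LINT t:{0..Ts}|lborel. Hnorm (s - 2) (f t))"

definition Cpath :: "real \<Rightarrow> real \<Rightarrow> (real \<Rightarrow> state) \<Rightarrow> bool" where
  "Cpath s T U \<longleftrightarrow> (\<forall>t\<in>{0..T}. U t \<in> Xs s) \<and>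
     (\<forall>t\<in>{0..T}. \<forall>e>0. \<exists>d>0. \<forall>t'\<in>{0..T}. \<bar>t' - t\<bar> < d \<longrightarrow> Xnorm s (stdiff (U t') (U t)) < e)"

definition conv :: "coeffs \<Rightarrow> coeffs \<Rightarrow> coeffs" where
  "conv a b = (\<lambda>k. infsum (\<lambda>j::int. a j * b (k - j)) UNIV)"

primrec cpow :: "nat \<Rightarrow> coeffs \<Rightarrow> coeffs" where
  "cpow 0 u = (\<lambda>k. if k = 0 then 1 else 0)"
| "cpow (Suc n) u = conv u (cpow n u)"

text \<open>The operator A(u,v) = ((I - d_x^2)^{-1} d_x v, d_x u) acting on the k-th Fourier mode,
and the k-th mode of e^{tA} as the exponential series.\<close>
definition modeA :: "int \<Rightarrow> complex \<times> complex \<Rightarrow> complex \<times> complex" where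
  "modeA k z = (\<i> * of_int k / (1 + (of_int k)\<^sup>2) * snd z, \<i> * of_int k * fst z)"

definition expA_mode :: "int \<Rightarrow> real \<Rightarrow> complex \<times> complex \<Rightarrow> complex \<times> complex" where
  "expA_mode k t z = (\<Sum>n. (t ^ n / fact n) *\<^sub>R ((modeA k ^^ n) z))"

text \<open>k-th mode of G(u,v) = ((I - d_x^2)^{-1} d_x (u^{p+1}/(p+1)), 0).\<close>
definition G_mode :: "nat \<Rightarrow> coeffs \<Rightarrow> int \<Rightarrow> complex \<times> complex" where
  "G_mode p u k = (\<i> * of_int k / (1 + (of_int k)\<^sup>2) * (cpow (p + 1) u k / of_nat (p + 1)), 0)"

text \<open>k-th mode of ((I - d_x^2)^{-1} g, 0).\<close>
definition F_mode :: "coeffs \<Rightarrow> int \<Rightarrow> complex \<times> complex" where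
  "F_mode g k = (g k / (1 + (of_int k)\<^sup>2), 0)"

definition mild :: "nat \<Rightarrow> real \<Rightarrow> real \<Rightarrow> state \<Rightarrow> (real \<Rightarrow> coeffs) \<Rightarrow> (real \<Rightarrow> state) \<Rightarrow> bool" where
  "mild p s T U0 f U \<longleftrightarrow> Cpath s T U \<and>
     (\<forall>t\<in>{0..T}. \<forall>k.
        set_integrable lborel {0..t} (\<lambda>\<tau>. expA_mode k (t - \<tau>) (G_mode p (fst (U \<tau>)) k)) \<and>
        set_integrable lborel {0..t} (\<lambda>\<tau>. expA_mode k (t - \<tau>) (F_mode (f \<tau>) k)) \<and>
        (fst (U t) k, snd (U t) k) =
          expA_mode k t (fst U0 k, snd U0 k)
          - (LINT \<tau>:{0..t}|lborel. expA_mode k (t - \<tau>) (G_mode p (fst (U \<tau>)) k))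
          + (LINT \<tau>:{0..t}|lborel. expA_mode k (t - \<tau>) (F_mode (f \<tau>) k)))"

end

theory Submission
  imports Defs
begin

text \<open>
  Scaling the \<open>k\<close>-th Fourier mode of \<open>(u, v)\<close> by \<open>((1 + k\<^sup>2)\<^bsup>s/2\<^esup>, (1 + k\<^sup>2)\<^bsup>(s-1)/2\<^esup>)\<close> identifies
  \<open>X\<^sup>s\<close> isometrically with a (real) subspace of \<open>\<ell>\<^sup>2(\<int>; \<complex> \<times> \<complex>)\<close>. There \<open>e\<^bsup>tA\<^esup>\<close> acts on every mode as a
  rotation by the angle \<open>t k / sqrt (1 + k\<^sup>2)\<close>, so it is an isometry group with bounded generator, and
  \<open>y(t) = e\<^bsup>-tA\<^esup> U(t)\<close> turns the mild equation into an integral equation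
  \<open>y(t) = b(t) - \<integral>\<^sub>0\<^sup>t e\<^bsup>-rA\<^esup> G(e\<^bsup>rA\<^esup> y(r)) dr\<close> with continuous data \<open>b\<close>.

  \<open>G\<close> is Lipschitz on bounded sets: since \<open>1 + k\<^sup>2 \<le> 2 (1 + j\<^sup>2) (1 + (k - j)\<^sup>2)\<close>, the Cauchy-Schwarz inequality bounds
  \<open>(1 + k\<^sup>2)\<^bsup>s/2\<^esup>\<close> times the \<open>k\<close>-th coefficient of a product uniformly in \<open>k\<close> for \<open>s \<ge> 0\<close>, and the multiplier
  \<open>k / (1 + k\<^sup>2)\<close> is square summable; this settles \<open>p = 1\<close>, and for \<open>p > 1\<close> the remaining factors are
  absorbed by the algebra property of \<open>H\<^sup>s\<close>, \<open>s > 1/2\<close>. Existence is then Picard iteration on a ball,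
  and uniqueness and Lipschitz dependence follow from a Gronwall argument. Real-valuedness comes from
  uniqueness, because complex conjugation maps solutions with real data to solutions.
\<close>

section \<open>Square-summable sequences\<close>

text \<open>The forcing is merely integrable in time and its measurability is given coefficient by
  coefficient, whereas the nonlinear term is continuous along a continuous path. The two time
  integrals are therefore treated differently: the first is formed coordinatewise and enters only
  through the data \<open>b\<close>, the second is an integral of a continuous function with values
  in a Banach space. Passing to \<open>y\<close> removes \<open>t\<close> from the integrands, so
  that both are plain indefinite integrals. The reality condition is not built into the sequence
  space, since neither completeness nor the product estimates see it; it is recovered for the fixed
  point afterwards. Two unit margins fix the existence time. Data of size \<open>a + b\<close> may
  grow by 1 within the neighbourhood, and the Picard ball exceeds the bound on the data by 1; hence
  the radius \<open>a + b + 2\<close>. By uniqueness every mild solution with data in the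
  neighbourhood is the Picard solution and stays in that ball, so a single Lipschitz constant serves
  all of them.\<close>

definition sq_summable :: "('i \<Rightarrow> 'a::real_normed_vector) \<Rightarrow> bool" where
  "sq_summable x \<longleftrightarrow> (\<lambda>i. (norm (x i))\<^sup>2) summable_on UNIV"

text \<open>Reduces membership and norm bounds to finite index sets, where the triangle and
  Cauchy-Schwarz inequalities for \<open>L2_set\<close> apply and sums may be interchanged
  freely.\<close>

lemma sq_summable_if_bounded:
  assumes "\<And>F. finite F \<Longrightarrow> L2_set (\<lambda>i. norm (x i)) F \<le> B"
  shows "sq_summable x" "sqrt (\<Sum>\<^sub>\<infinity>i. (norm (x i))\<^sup>2) \<le> B"
proof -
  have B: "0 \<le> B"
    using assms[of "{}"] by simp
  have sum_le: "(\<Sum>i\<in>F. (norm (x i))\<^sup>2) \<le> B\<^sup>2" if "finite F" for F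
    using assms[OF that] unfolding L2_set_def by (simp add: real_sqrt_le_iff' sqrt_le_D)
  show "sq_summable x"
    unfolding sq_summable_def
    by (rule nonneg_bdd_above_summable_on) (use sum_le in \<open>auto intro!: bdd_aboveI\<close>)
  then have "(\<Sum>\<^sub>\<infinity>i. (norm (x i))\<^sup>2) \<le> B\<^sup>2"
    unfolding sq_summable_def by (rule infsum_le_finite_sums) (use sum_le in auto)
  then show "sqrt (\<Sum>\<^sub>\<infinity>i. (norm (x i))\<^sup>2) \<le> B"
    using B real_le_lsqrt by blast
qed

lemma L2_set_le_sqrt_infsum:
  assumes "sq_summable x" "finite F"
  shows "L2_set (\<lambda>i. norm (x i)) F \<le> sqrt (\<Sum>\<^sub>\<infinity>i. (norm (x i))\<^sup>2)"
  unfolding L2_set_def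
  using assms by (auto simp: sq_summable_def intro!: finite_sum_le_infsum)

lemma L2_set_norm_add_le:
  "L2_set (\<lambda>i. norm (x i + y i)) F \<le> L2_set (\<lambda>i. norm (x i)) F + L2_set (\<lambda>i. norm (y i)) F"
  by (rule order.trans[OF L2_set_mono L2_set_triangle_ineq]) (auto intro: norm_triangle_ineq)

lemma L2_set_norm_scaleR:
  "L2_set (\<lambda>i. norm (c *\<^sub>R x i)) F = \<bar>c\<bar> * L2_set (\<lambda>i. norm (x i)) F"
  by (simp add: L2_set_right_distrib)

text \<open>A type, rather than a set of sequences, makes the fixed point theorem, the space of
  bounded continuous functions and the vector-valued integral applicable.\<close>

typedef (overloaded) ('i, 'a) ell2 = "{x :: 'i \<Rightarrow> 'a::real_normed_vector. sq_summable x}"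
  morphisms coord Abs_ell2
  by (rule exI[of _ "\<lambda>_. 0"]) (simp add: sq_summable_def)

setup_lifting type_definition_ell2

lemma coord_sq_summable [simp]: "sq_summable (coord x)"
  using coord[of x] by simp

lemma ell2_eqI: "(\<And>i. coord x i = coord y i) \<Longrightarrow> x = y"
  by (simp add: coord_inject[symmetric] fun_eq_iff)

instantiation ell2 :: (type, real_normed_vector) real_normed_vector
begin

lift_definition zero_ell2 :: "('a, 'b) ell2" is "\<lambda>_. 0"
  by (simp add: sq_summable_def)

lift_definition plus_ell2 :: "('a, 'b) ell2 \<Rightarrow> ('a, 'b) ell2 \<Rightarrow> ('a, 'b) ell2"
  is "\<lambda>x y i. x i + y i"
  by (rule sq_summable_if_bounded, rule order.trans[OF L2_set_norm_add_le], rule add_mono)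
     (rule L2_set_le_sqrt_infsum, assumption+)+

lift_definition scaleR_ell2 :: "real \<Rightarrow> ('a, 'b) ell2 \<Rightarrow> ('a, 'b) ell2"
  is "\<lambda>c x i. c *\<^sub>R x i"
  by (rule sq_summable_if_bounded, subst L2_set_norm_scaleR, rule mult_left_mono,
      rule L2_set_le_sqrt_infsum) auto

lift_definition uminus_ell2 :: "('a, 'b) ell2 \<Rightarrow> ('a, 'b) ell2" is "\<lambda>x i. - x i"
  by (simp add: sq_summable_def)

definition minus_ell2 :: "('a, 'b) ell2 \<Rightarrow> ('a, 'b) ell2 \<Rightarrow> ('a, 'b) ell2" where
  "minus_ell2 x y = x + - y"

lift_definition norm_ell2 :: "('a, 'b) ell2 \<Rightarrow> real"
  is "\<lambda>x. sqrt (\<Sum>\<^sub>\<infinity>i. (norm (x i))\<^sup>2)" .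

definition dist_ell2 :: "('a, 'b) ell2 \<Rightarrow> ('a, 'b) ell2 \<Rightarrow> real" where
  "dist_ell2 x y = norm (x - y)"

definition sgn_ell2 :: "('a, 'b) ell2 \<Rightarrow> ('a, 'b) ell2" where
  "sgn_ell2 x = inverse (norm x) *\<^sub>R x"

definition uniformity_ell2 :: "(('a, 'b) ell2 \<times> ('a, 'b) ell2) filter" where
  "uniformity_ell2 = (INF e\<in>{0<..}. principal {(x, y). dist x y < e})"

definition open_ell2 :: "('a, 'b) ell2 set \<Rightarrow> bool" where
  "open_ell2 U = (\<forall>x\<in>U. eventually (\<lambda>(x', y). x' = x \<longrightarrow> y \<in> U) uniformity)"

instance
proof
  fix x y z :: "('a, 'b) ell2" and a b :: real
  show "x + y + z = x + (y + z)" "x + y = y + x" "0 + x = x" "- x + x = 0"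
    "a *\<^sub>R (x + y) = a *\<^sub>R x + a *\<^sub>R y" "(a + b) *\<^sub>R x = a *\<^sub>R x + b *\<^sub>R x"
    "a *\<^sub>R b *\<^sub>R x = (a * b) *\<^sub>R x" "1 *\<^sub>R x = x"
    by (transfer; simp add: algebra_simps)+
  show "x - y = x + - y"
    by (rule minus_ell2_def)
  show "dist x y = norm (x - y)" "sgn x = inverse (norm x) *\<^sub>R x"
    by (simp_all add: dist_ell2_def sgn_ell2_def)
  show "(norm x = 0) = (x = 0)"
  proof
    assume n: "norm x = 0"
    have "norm (coord x i) \<le> 0" for i
      using L2_set_le_sqrt_infsum[OF coord_sq_summable, of "{i}" x] n
      by (simp add: norm_ell2.rep_eq)
    then show "x = 0"
      by (intro ell2_eqI) (simp add: zero_ell2.rep_eq)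
  qed (transfer, simp)
  show "norm (x + y) \<le> norm x + norm y"
    by (transfer, rule sq_summable_if_bounded, rule order.trans[OF L2_set_norm_add_le], rule add_mono)
       (rule L2_set_le_sqrt_infsum, assumption+)+
  show "norm (a *\<^sub>R x) = \<bar>a\<bar> * norm x"
    by transfer (simp add: power_mult_distrib infsum_cmult_right' real_sqrt_mult)
  show "uniformity = (INF e\<in>{0<..}. principal {(x, y). dist x (y :: ('a, 'b) ell2) < e})"
    by (rule uniformity_ell2_def)
  show "open U = (\<forall>x\<in>U. eventually (\<lambda>(x', y). x' = x \<longrightarrow> y \<in> U) uniformity)" for U :: "('a, 'b) ell2 set"
    by (rule open_ell2_def)
qed

end

lemma coord_simps [simp]:
  "coord 0 i = 0" "coord (x + y) i = coord x i + coord y i"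
  "coord (c *\<^sub>R x) i = c *\<^sub>R coord x i" "coord (- x) i = - coord x i"
  "coord (x - y) i = coord x i - coord y i"
  unfolding minus_ell2_def by (transfer; simp)+

lemma L2_set_coord_le_norm: "finite F \<Longrightarrow> L2_set (\<lambda>i. norm (coord x i)) F \<le> norm x"
  unfolding norm_ell2.rep_eq by (rule L2_set_le_sqrt_infsum) auto

lemma norm_coord_le: "norm (coord x i) \<le> norm x"
  using L2_set_coord_le_norm[of "{i}" x] by simp

lemma norm_ell2_le:
  "(\<And>F. finite F \<Longrightarrow> L2_set (\<lambda>i. norm (coord x i)) F \<le> B) \<Longrightarrow> norm x \<le> B"
  unfolding norm_ell2.rep_eq by (rule sq_summable_if_bounded)

lemma coord_Abs_ell2_if_bounded:
  assumes "\<And>F. finite F \<Longrightarrow> L2_set (\<lambda>i. norm (x i)) F \<le> B"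
  shows "coord (Abs_ell2 x) = x" "norm (Abs_ell2 x) \<le> B"
proof -
  show c: "coord (Abs_ell2 x) = x"
    using sq_summable_if_bounded(1)[of x B] assms by (simp add: Abs_ell2_inverse)
  show "norm (Abs_ell2 x) \<le> B"
    by (rule norm_ell2_le) (simp add: c assms)
qed

lemma bounded_linear_coord: "bounded_linear (\<lambda>x. coord x i)"
  by (rule bounded_linear_intro[of _ 1]) (auto intro: norm_coord_le)

lemma continuous_on_coord: "continuous_on S f \<Longrightarrow> continuous_on S (\<lambda>t. coord (f t) i)"
  by (rule bounded_linear.continuous_on[OF bounded_linear_coord])

instance ell2 :: (type, banach) banach
proof
  fix X :: "nat \<Rightarrow> ('a, 'b) ell2"
  assume X: "Cauchy X"
  have "Cauchy (\<lambda>n. coord (X n) i)" for i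
    by (rule bounded_linear.Cauchy[OF bounded_linear_coord X])
  then obtain l where l: "\<And>i. (\<lambda>n. coord (X n) i) \<longlonglongrightarrow> l i"
    unfolding Cauchy_convergent_iff convergent_def by metis
  have tail: "\<exists>N. \<forall>n\<ge>N. \<forall>F. finite F \<longrightarrow> L2_set (\<lambda>i. norm (coord (X n) i - l i)) F \<le> e"
    if e: "e > 0" for e
  proof -
    obtain N where N: "\<And>m n. m \<ge> N \<Longrightarrow> n \<ge> N \<Longrightarrow> norm (X n - X m) < e"
      using CauchyD[OF X e] by blast
    have "L2_set (\<lambda>i. norm (coord (X n) i - l i)) F \<le> e" if "n \<ge> N" "finite F" for n F
    proof (rule tendsto_upperbound)
      show "((\<lambda>m. L2_set (\<lambda>i. norm (coord (X n) i - coord (X m) i)) F) \<longlongrightarrow>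
          L2_set (\<lambda>i. norm (coord (X n) i - l i)) F) sequentially"
        unfolding L2_set_def by (intro tendsto_intros l)
      show "\<forall>\<^sub>F m in sequentially. L2_set (\<lambda>i. norm (coord (X n) i - coord (X m) i)) F \<le> e"
        using eventually_ge_at_top[of N]
      proof eventually_elim
        case (elim m)
        then show ?case
          using L2_set_coord_le_norm[of F "X n - X m"] N[of m n] that by simp
      qed
    qed auto
    then show ?thesis by blast
  qed
  obtain N where "\<forall>n\<ge>N. \<forall>F. finite F \<longrightarrow> L2_set (\<lambda>i. norm (coord (X n) i - l i)) F \<le> 1"
    using tail[of 1] by auto
  \<comment> \<open>The coordinatewise limit \<open>l\<close> is not yet known to be square
    summable, but its distance to \<open>X N\<close> is bounded by 1; the limit is then recovered as
    \<open>X N\<close> minus this difference.\<close>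
  then have "sq_summable (\<lambda>i. coord (X N) i - l i)"
    by (intro sq_summable_if_bounded(1)[of _ 1]) auto
  then have d: "coord (Abs_ell2 (\<lambda>i. coord (X N) i - l i)) i = coord (X N) i - l i" for i
    by (simp add: Abs_ell2_inverse)
  define L where "L = X N - Abs_ell2 (\<lambda>i. coord (X N) i - l i)"
  have L: "coord L i = l i" for i
    by (simp add: L_def d)
  have "X \<longlonglongrightarrow> L"
  proof (rule LIMSEQ_I)
    fix r :: real assume "r > 0"
    then obtain M where M: "\<forall>n\<ge>M. \<forall>F. finite F \<longrightarrow> L2_set (\<lambda>i. norm (coord (X n) i - l i)) F \<le> r/2"
      using tail[of "r/2"] by auto
    have "norm (X n - L) \<le> r/2" if "n \<ge> M" for n
      by (rule norm_ell2_le) (use M that in \<open>simp add: L\<close>)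
    then show "\<exists>no. \<forall>n\<ge>no. norm (X n - L) < r"
      using \<open>r > 0\<close> by (intro exI[of _ M]) fastforce
  qed
  then show "convergent X"
    by (auto simp: convergent_def)
qed

text \<open>Covers everything that acts mode by mode: projections, injections and rotations. The
  absolute value of \<open>C\<close> is there because the hypothesis does not force
  \<open>C \<ge> 0\<close> when \<open>'a\<close> is trivial.\<close>

lemma ell2_comp_bounded:
  fixes z :: "('i, 'a::real_normed_vector) ell2" and m :: "'i \<Rightarrow> 'a \<Rightarrow> 'b::real_normed_vector"
  assumes m: "\<And>i x. norm (m i x) \<le> C * norm x"
  shows "coord (Abs_ell2 (\<lambda>i. m i (coord z i))) i = m i (coord z i)"
    "norm (Abs_ell2 (\<lambda>i. m i (coord z i))) \<le> \<bar>C\<bar> * norm z"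
proof -
  have "L2_set (\<lambda>i. norm (m i (coord z i))) F \<le> \<bar>C\<bar> * norm z" if "finite F" for F
  proof -
    have "L2_set (\<lambda>i. norm (m i (coord z i))) F \<le> L2_set (\<lambda>i. \<bar>C\<bar> * norm (coord z i)) F"
      by (intro L2_set_mono order.trans[OF m]) (auto intro: mult_right_mono)
    also have "\<dots> = \<bar>C\<bar> * L2_set (\<lambda>i. norm (coord z i)) F"
      by (simp add: L2_set_right_distrib)
    finally show ?thesis
      using L2_set_coord_le_norm[OF that, of z] by (meson abs_ge_zero mult_left_mono order.trans)
  qed
  from coord_Abs_ell2_if_bounded[of _ "\<bar>C\<bar> * norm z", OF this]
  show "coord (Abs_ell2 (\<lambda>i. m i (coord z i))) i = m i (coord z i)"
    "norm (Abs_ell2 (\<lambda>i. m i (coord z i))) \<le> \<bar>C\<bar> * norm z"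
    by (simp_all)
qed

section \<open>Integral equations in Banach spaces\<close>

text \<open>Gronwall's inequality by a weighted maximum. The Lipschitz bound is asked for only along
  the two given curves, so a nonlinearity that is Lipschitz merely on bounded sets
  qualifies.\<close>

lemma integral_equation_stability:
  fixes y1 y2 b1 b2 :: "real \<Rightarrow> 'a::banach"
  assumes "0 \<le> K"
    and y: "continuous_on {0..T} y1" "continuous_on {0..T} y2"
    and M: "continuous_on {0..T} (\<lambda>t. M t (y1 t))" "continuous_on {0..T} (\<lambda>t. M t (y2 t))"
    and lip: "\<And>t. t \<in> {0..T} \<Longrightarrow> norm (M t (y1 t) - M t (y2 t)) \<le> K * norm (y1 t - y2 t)"
    and eq: "\<And>t. t \<in> {0..T} \<Longrightarrow> y1 t = b1 t + integral {0..t} (\<lambda>r. M r (y1 r))"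
            "\<And>t. t \<in> {0..T} \<Longrightarrow> y2 t = b2 t + integral {0..t} (\<lambda>r. M r (y2 r))"
    and b: "\<And>t. t \<in> {0..T} \<Longrightarrow> norm (b1 t - b2 t) \<le> c"
    and t: "t \<in> {0..T}"
  shows "norm (y1 t - y2 t) \<le> 2 * c * exp (2 * K * T)"
proof -
  \<comment> \<open>The weight \<open>exp (- 2 K t)\<close> makes the integral term absorb only half of the supremum.\<close>
  define D where "D t = norm (y1 t - y2 t)" for t
  have "continuous_on {0..T} (\<lambda>t. exp (- (2 * K * t)) * D t)"
    unfolding D_def by (intro continuous_intros y)
  then obtain t0 where t0: "t0 \<in> {0..T}"
    and max: "\<And>t. t \<in> {0..T} \<Longrightarrow> exp (- (2 * K * t)) * D t \<le> exp (- (2 * K * t0)) * D t0"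
    using continuous_attains_sup[of "{0..T}" "\<lambda>t. exp (- (2 * K * t)) * D t"] t by auto
  define S where "S = exp (- (2 * K * t0)) * D t0"
  have D_le: "D t \<le> S * exp (2 * K * t)" if "t \<in> {0..T}" for t
    using max[OF that] unfolding S_def[symmetric] by (simp add: exp_minus field_simps)
  have S0: "0 \<le> S"
    unfolding S_def D_def by simp
  have c: "0 \<le> c"
    using b[OF t] norm_ge_zero order.trans by blast
  have sub: "{0..t0} \<subseteq> {0..T}"
    using t0 by auto
  have int: "(\<lambda>r. M r (y1 r)) integrable_on {0..t0}" "(\<lambda>r. M r (y2 r)) integrable_on {0..t0}"
    by (auto intro!: integrable_continuous_interval continuous_on_subset[OF M(1) sub]
        continuous_on_subset[OF M(2) sub])
  \<comment> \<open>Written this way the antiderivative involves no division by \<open>K\<close>, so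
    \<open>K = 0\<close> is included.\<close>
  have fund: "((\<lambda>r. K * (S * exp (2 * K * r))) has_integral
      S / 2 * exp (2 * K * t0) - S / 2 * exp (2 * K * 0)) {0..t0}"
    by (rule fundamental_theorem_of_calculus)
       (use t0 in \<open>auto intro!: derivative_eq_intros simp: has_real_derivative_iff_has_vector_derivative[symmetric]\<close>)
  have "D t0 = norm (b1 t0 - b2 t0 + integral {0..t0} (\<lambda>r. M r (y1 r) - M r (y2 r)))"
    unfolding D_def integral_diff[OF int]
    using eq(1)[OF t0] eq(2)[OF t0] by (metis add_diff_add)
  also have "\<dots> \<le> c + norm (integral {0..t0} (\<lambda>r. M r (y1 r) - M r (y2 r)))"
    by (rule order.trans[OF norm_triangle_ineq]) (use b[OF t0] in simp)
  also have "norm (integral {0..t0} (\<lambda>r. M r (y1 r) - M r (y2 r)))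
      \<le> integral {0..t0} (\<lambda>r. K * (S * exp (2 * K * r)))"
  proof (rule integral_norm_bound_integral)
    show "norm (M r (y1 r) - M r (y2 r)) \<le> K * (S * exp (2 * K * r))" if "r \<in> {0..t0}" for r
      using lip[of r] D_le[of r] that sub \<open>0 \<le> K\<close> unfolding D_def
      by (meson mult_left_mono order.trans subsetD)
  qed (use int fund in \<open>auto intro: integrable_diff\<close>)
  also have "integral {0..t0} (\<lambda>r. K * (S * exp (2 * K * r))) = S / 2 * exp (2 * K * t0) - S / 2"
    using integral_unique[OF fund] by simp
  finally have "D t0 \<le> c + S / 2 * exp (2 * K * t0) - S / 2"
    by simp
  moreover have "D t0 = S * exp (2 * K * t0)"
    unfolding S_def by (simp add: exp_minus)
  ultimately have "S * exp (2 * K * t0) \<le> 2 * c"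
    using S0 by (simp add: field_simps)
  moreover have "S \<le> S * exp (2 * K * t0)"
    using S0 t0 \<open>0 \<le> K\<close> by (simp add: mult_le_cancel_left1)
  ultimately have "S \<le> 2 * c" by simp
  moreover have "exp (2 * K * t) \<le> exp (2 * K * T)"
    using t \<open>0 \<le> K\<close> by (simp add: mult_left_mono)
  ultimately have "S * exp (2 * K * t) \<le> 2 * c * exp (2 * K * T)"
    using c by (intro mult_mono) auto
  with D_le[OF t] show ?thesis
    unfolding D_def by simp
qed

text \<open>Contraction on the ball of radius \<open>B + 1\<close>. Since \<open>M t 0 = 0\<close>,
  the Lipschitz bound is also a growth bound, so the integral term has norm at most
  \<open>T * K * (B + 1)\<close> and the ball is mapped into itself.\<close>

lemma integral_equation_solvable:
  fixes b :: "real \<Rightarrow> 'a::banach"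
  assumes "0 \<le> T" "0 \<le> K"
    and b: "continuous_on {0..T} b" "\<And>t. t \<in> {0..T} \<Longrightarrow> norm (b t) \<le> B"
    and M: "\<And>y. continuous_on {0..T} y \<Longrightarrow> continuous_on {0..T} (\<lambda>t. M t (y t))"
    and lip: "\<And>t x y. t \<in> {0..T} \<Longrightarrow> norm x \<le> B + 1 \<Longrightarrow> norm y \<le> B + 1 \<Longrightarrow>
        norm (M t x - M t y) \<le> K * norm (x - y)"
    and M0: "\<And>t. t \<in> {0..T} \<Longrightarrow> M t 0 = 0"
    and small: "T * K * (B + 1) \<le> 1 / 2"
  obtains y where "continuous_on {0..T} y" "\<And>t. t \<in> {0..T} \<Longrightarrow> norm (y t) \<le> B + 1"
    "\<And>t. t \<in> {0..T} \<Longrightarrow> y t = b t + integral {0..t} (\<lambda>r. M r (y r))"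
proof -
  \<comment> \<open>Bounded continuous functions are available on the whole line; the retraction
    onto \<open>{0..T}\<close> extends every iterate by constants.\<close>
  define cl where "cl t = max 0 (min T t)" for t :: real
  have cl: "cl t \<in> {0..T}" for t
    using \<open>0 \<le> T\<close> by (auto simp: cl_def)
  have cl_id: "cl t = t" if "t \<in> {0..T}" for t
    using that by (auto simp: cl_def)
  have B: "0 \<le> B"
    using b(2)[of 0] \<open>0 \<le> T\<close> by (auto intro: order.trans[OF norm_ge_zero])
  \<comment> \<open>As \<open>B \<ge> 0\<close>, the smallness assumption that keeps the ball
    invariant also gives the contraction factor.\<close>
  have TK: "T * K \<le> 1 / 2"
    using small mult_nonneg_nonneg[OF mult_nonneg_nonneg[OF \<open>0 \<le> T\<close> \<open>0 \<le> K\<close>] B]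
    by (simp add: distrib_left)
  define \<Psi> where "\<Psi> y t = b (cl t) + integral {0..cl t} (\<lambda>r. M r (y r))" for y :: "real \<Rightarrow> 'a" and t
  have My: "continuous_on {0..T} (\<lambda>t. M t (apply_bcontfun y t))" for y :: "real \<Rightarrow>\<^sub>C 'a"
    by (rule M) simp
  have Mint: "(\<lambda>r. M r (apply_bcontfun y r)) integrable_on {0..t}" if "t \<in> {0..T}" for y :: "real \<Rightarrow>\<^sub>C 'a" and t
    by (rule integrable_continuous_interval, rule continuous_on_subset[OF My]) (use that in auto)
  have bc: "\<Psi> (apply_bcontfun y) \<in> bcontfun" for y :: "real \<Rightarrow>\<^sub>C 'a"
  proof -
    have c: "continuous_on {0..T} (\<lambda>t. b t + integral {0..t} (\<lambda>r. M r (apply_bcontfun y r)))"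
      by (intro continuous_intros b indefinite_integral_continuous_1 Mint) (use \<open>0 \<le> T\<close> in auto)
    have "continuous_on UNIV (\<Psi> (apply_bcontfun y))"
      unfolding \<Psi>_def
      by (rule continuous_on_compose2[OF c]) (auto simp: cl cl_def[abs_def] \<open>0 \<le> T\<close> intro!: continuous_intros)
    moreover have "range (\<Psi> (apply_bcontfun y)) \<subseteq> (\<lambda>t. b t + integral {0..t} (\<lambda>r. M r (apply_bcontfun y r))) ` {0..T}"
      using cl by (auto simp: \<Psi>_def)
    ultimately show ?thesis
      using bounded_subset[OF compact_imp_bounded[OF compact_continuous_image[OF c compact_Icc]]]
      by (auto simp: bcontfun_def)
  qed
  define \<Phi> where "\<Phi> y = Bcontfun (\<Psi> (apply_bcontfun y))" for y :: "real \<Rightarrow>\<^sub>C 'a"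
  have \<Phi>: "apply_bcontfun (\<Phi> y) t = b (cl t) + integral {0..cl t} (\<lambda>r. M r (apply_bcontfun y r))" for y t
    unfolding \<Phi>_def Bcontfun_inverse[OF bc] by (simp add: \<Psi>_def)
  have diff: "norm (integral {0..cl t} (\<lambda>r. M r (apply_bcontfun y r)) - integral {0..cl t} (\<lambda>r. M r (apply_bcontfun z r)))
      \<le> T * K * dist y z"
    if "y \<in> cball 0 (B + 1)" "z \<in> cball 0 (B + 1)" for y z :: "real \<Rightarrow>\<^sub>C 'a" and t
  proof -
    have le: "norm (apply_bcontfun w r) \<le> B + 1" if "w \<in> cball 0 (B + 1)" for w :: "real \<Rightarrow>\<^sub>C 'a" and r
      using that norm_bounded[of w r] by simp
    have "norm (integral {0..cl t} (\<lambda>r. M r (apply_bcontfun y r) - M r (apply_bcontfun z r)))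
        \<le> integral {0..cl t} (\<lambda>_. K * dist y z)"
    proof (rule integral_norm_bound_integral)
      show "norm (M r (apply_bcontfun y r) - M r (apply_bcontfun z r)) \<le> K * dist y z"
        if r: "r \<in> {0..cl t}" for r
      proof -
        have "r \<in> {0..T}" using r cl[of t] by auto
        from lip[OF this le le] that \<open>y \<in> _\<close> \<open>z \<in> _\<close>
        have "norm (M r (apply_bcontfun y r) - M r (apply_bcontfun z r)) \<le> K * dist (apply_bcontfun y r) (apply_bcontfun z r)"
          by (simp add: dist_norm)
        also have "\<dots> \<le> K * dist y z"
          using \<open>0 \<le> K\<close> dist_bounded by (intro mult_left_mono)
        finally show ?thesis .
      qed
    qed (use Mint cl in \<open>auto intro!: integrable_diff\<close>)
    also have "\<dots> = cl t * (K * dist y z)"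
      using cl[of t] by simp
    also have "\<dots> \<le> T * (K * dist y z)"
      using cl[of t] \<open>0 \<le> K\<close> by (intro mult_right_mono) auto
    finally show ?thesis
      by (simp only: integral_diff[OF Mint[OF cl] Mint[OF cl]] mult.assoc)
  qed
  have "\<exists>!y. y \<in> cball 0 (B + 1) \<and> \<Phi> y = y"
  proof (rule Banach_fix)
    show "complete (cball (0 :: real \<Rightarrow>\<^sub>C 'a) (B + 1))"
      by (simp add: complete_eq_closed)
    show "cball (0 :: real \<Rightarrow>\<^sub>C 'a) (B + 1) \<noteq> {}"
      using B by simp
    show "\<Phi> ` cball 0 (B + 1) \<subseteq> cball 0 (B + 1)"
    proof (rule image_subsetI)
      fix y :: "real \<Rightarrow>\<^sub>C 'a" assume y: "y \<in> cball 0 (B + 1)"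
      have "norm (apply_bcontfun (\<Phi> y) t) \<le> B + 1" for t
      proof -
        have "integral {0..cl t} (\<lambda>r. M r (apply_bcontfun 0 r)) = integral {0..cl t} (\<lambda>r. 0)"
          using cl[of t] by (intro integral_cong) (auto simp: M0)
        \<comment> \<open>Comparison with the zero function turns the Lipschitz estimate into a
          bound on the integral itself.\<close>
        with diff[OF y, of 0 t] B
        have "norm (integral {0..cl t} (\<lambda>r. M r (apply_bcontfun y r))) \<le> T * K * norm y"
          by simp
        also have "\<dots> \<le> T * K * (B + 1)"
          using y \<open>0 \<le> T\<close> \<open>0 \<le> K\<close> by (intro mult_left_mono) auto
        finally have "norm (integral {0..cl t} (\<lambda>r. M r (apply_bcontfun y r))) \<le> 1"
          using small by linarith
        then show ?thesis
          unfolding \<Phi> using b(2)[OF cl[of t]] by (meson add_mono norm_triangle_ineq order.trans)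
      qed
      then show "\<Phi> y \<in> cball 0 (B + 1)"
        by (auto simp: dist_norm intro: norm_bound)
    qed
    show "dist (\<Phi> x) (\<Phi> y) \<le> 1 / 2 * dist x y"
      if "x \<in> cball 0 (B + 1)" "y \<in> cball 0 (B + 1)" for x y
    proof (rule dist_bound)
      fix t
      have "dist (apply_bcontfun (\<Phi> x) t) (apply_bcontfun (\<Phi> y) t) \<le> T * K * dist x y"
        using diff[OF that, of t] by (simp add: \<Phi> dist_norm)
      also have "\<dots> \<le> 1 / 2 * dist x y"
        using TK by (intro mult_right_mono) auto
      finally show "dist (apply_bcontfun (\<Phi> x) t) (apply_bcontfun (\<Phi> y) t) \<le> 1 / 2 * dist x y" .
    qed
  qed auto
  then obtain y where y: "y \<in> cball 0 (B + 1)" "\<Phi> y = y"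
    by blast
  show thesis
  proof (rule that)
    show "continuous_on {0..T} (apply_bcontfun y)"
      by simp
    show "norm (apply_bcontfun y t) \<le> B + 1" for t
      using y(1) norm_bounded[of y t] by simp
    show "apply_bcontfun y t = b t + integral {0..t} (\<lambda>r. M r (apply_bcontfun y r))" if "t \<in> {0..T}" for t
      using \<Phi>[of y t] y(2) cl_id[OF that] by simp
  qed
qed

text \<open>Minkowski's integral inequality, by duality: pair the vector of integrals with itself.\<close>
lemma L2_set_integral_le:
  fixes g :: "'i \<Rightarrow> real \<Rightarrow> 'a::{real_inner, banach}"
  assumes F: "finite F" and g: "\<And>i. i \<in> F \<Longrightarrow> g i integrable_on {a..b}" and \<phi>: "\<phi> integrable_on {a..b}"
    and le: "\<And>t. t \<in> {a..b} \<Longrightarrow> L2_set (\<lambda>i. norm (g i t)) F \<le> \<phi> t"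
  shows "L2_set (\<lambda>i. norm (integral {a..b} (g i))) F \<le> integral {a..b} \<phi>"
proof -
  define I where "I i = integral {a..b} (g i)" for i
  define S where "S = L2_set (\<lambda>i. norm (I i)) F"
  have S0: "0 \<le> S"
    unfolding S_def by simp
  have gI: "(\<lambda>t. I i \<bullet> g i t) integrable_on {a..b}" if "i \<in> F" for i
    using integrable_linear[OF g[OF that] bounded_linear_inner_right[of "I i"]] by (simp add: o_def)
  have "S\<^sup>2 = (\<Sum>i\<in>F. I i \<bullet> integral {a..b} (g i))"
    unfolding S_def L2_set_def I_def by (simp add: sum_nonneg power2_norm_eq_inner)
  also have "\<dots> = (\<Sum>i\<in>F. integral {a..b} (\<lambda>t. I i \<bullet> g i t))"
    by (intro sum.cong refl)
       (simp add: integral_linear[OF g bounded_linear_inner_right, symmetric] o_def)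
  also have "\<dots> = integral {a..b} (\<lambda>t. \<Sum>i\<in>F. I i \<bullet> g i t)"
    by (simp add: integral_sum gI F)
  also have "\<dots> \<le> integral {a..b} (\<lambda>t. S * \<phi> t)"
  proof (rule integral_le)
    show "(\<lambda>t. \<Sum>i\<in>F. I i \<bullet> g i t) integrable_on {a..b}"
      by (intro integrable_sum gI F)
    show "(\<lambda>t. S * \<phi> t) integrable_on {a..b}"
      by (rule integrable_on_mult_right[OF \<phi>])
    fix t assume t: "t \<in> {a..b}"
    have "(\<Sum>i\<in>F. I i \<bullet> g i t) \<le> (\<Sum>i\<in>F. \<bar>norm (I i)\<bar> * \<bar>norm (g i t)\<bar>)"
      by (intro sum_mono) (simp add: norm_cauchy_schwarz)
    also have "\<dots> \<le> S * L2_set (\<lambda>i. norm (g i t)) F"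
      unfolding S_def by (rule L2_set_mult_ineq)
    also have "\<dots> \<le> S * \<phi> t"
      by (intro mult_left_mono le t S0)
    finally show "(\<Sum>i\<in>F. I i \<bullet> g i t) \<le> S * \<phi> t" .
  qed
  also have "\<dots> = S * integral {a..b} \<phi>"
    by simp
  finally have "S * S \<le> S * integral {a..b} \<phi>"
    by (simp add: power2_eq_square)
  moreover have "0 \<le> integral {a..b} \<phi>"
    by (intro integral_nonneg \<phi>) (use le L2_set_nonneg order.trans in blast)
  ultimately show ?thesis
    using S0 unfolding S_def[symmetric] I_def[symmetric] by (cases "S = 0") auto
qed

text \<open>Formed coordinatewise because the forcing is only known to be measurable in each
  coefficient. An integrable scalar majorant \<open>\<phi>\<close> of the norm makes the sequence of
  integrals square summable.\<close>

definition ell2_integral :: "(real \<Rightarrow> ('i, 'a::banach) ell2) \<Rightarrow> real \<Rightarrow> ('i, 'a) ell2" where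
  "ell2_integral h t = Abs_ell2 (\<lambda>i. integral {0..t} (\<lambda>r. coord (h r) i))"

context
  fixes h :: "real \<Rightarrow> ('i, 'a::{real_inner, banach}) ell2" and T and \<phi> :: "real \<Rightarrow> real"
  assumes h: "\<And>i. (\<lambda>r. coord (h r) i) integrable_on {0..T}"
    and \<phi>: "\<phi> integrable_on {0..T}" and h_le: "\<And>r. r \<in> {0..T} \<Longrightarrow> norm (h r) \<le> \<phi> r"
begin

lemma coord_ell2_integral:
  assumes t: "t \<in> {0..T}"
  shows "coord (ell2_integral h t) i = integral {0..t} (\<lambda>r. coord (h r) i)"
    "norm (ell2_integral h t) \<le> integral {0..t} \<phi>"
proof -
  have "L2_set (\<lambda>i. norm (integral {0..t} (\<lambda>r. coord (h r) i))) F \<le> integral {0..t} \<phi>"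
    if "finite F" for F
  proof (rule L2_set_integral_le[OF \<open>finite F\<close>])
    show "(\<lambda>r. coord (h r) i) integrable_on {0..t}" for i
      by (rule integrable_on_subinterval[OF h]) (use t in auto)
    show "\<phi> integrable_on {0..t}"
      by (rule integrable_on_subinterval[OF \<phi>]) (use t in auto)
    show "L2_set (\<lambda>i. norm (coord (h r) i)) F \<le> \<phi> r" if "r \<in> {0..t}" for r
      using h_le[of r] L2_set_coord_le_norm[OF \<open>finite F\<close>, of "h r"] that t by auto
  qed
  from coord_Abs_ell2_if_bounded[OF this]
  show "coord (ell2_integral h t) i = integral {0..t} (\<lambda>r. coord (h r) i)"
    "norm (ell2_integral h t) \<le> integral {0..t} \<phi>"
    unfolding ell2_integral_def by simp_all
qed

text \<open>Increments are controlled by those of the scalar integral of \<open>\<phi>\<close>,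
  whose continuity is thereby inherited by \<open>ell2_integral\<close>.\<close>

lemma norm_ell2_integral_diff_le:
  assumes "s \<in> {0..T}" "t \<in> {0..T}" "s \<le> t"
  shows "norm (ell2_integral h t - ell2_integral h s) \<le> integral {0..t} \<phi> - integral {0..s} \<phi>"
proof (rule norm_ell2_le)
  fix F :: "'i set" assume F: "finite F"
  have sub: "{s..t} \<subseteq> {0..T}" "{0..t} \<subseteq> {0..T}"
    using assms by auto
  have int: "(\<lambda>r. coord (h r) i) integrable_on {0..t}" "\<phi> integrable_on {0..t}" for i
    using integrable_on_subinterval[OF h sub(2)] integrable_on_subinterval[OF \<phi> sub(2)] by auto
  have "coord (ell2_integral h t - ell2_integral h s) i = integral {s..t} (\<lambda>r. coord (h r) i)" for i
    using Henstock_Kurzweil_Integration.integral_combine[OF _ _ int(1), of s i] assms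
    by (simp add: coord_ell2_integral algebra_simps)
  moreover have "integral {0..t} \<phi> - integral {0..s} \<phi> = integral {s..t} \<phi>"
    using Henstock_Kurzweil_Integration.integral_combine[OF _ _ int(2), of s] assms
    by (simp add: algebra_simps)
  moreover have "L2_set (\<lambda>i. norm (integral {s..t} (\<lambda>r. coord (h r) i))) F \<le> integral {s..t} \<phi>"
  proof (rule L2_set_integral_le[OF \<open>finite F\<close>])
    show "(\<lambda>r. coord (h r) i) integrable_on {s..t}" for i
      by (rule integrable_on_subinterval[OF h sub(1)])
    show "\<phi> integrable_on {s..t}"
      by (rule integrable_on_subinterval[OF \<phi> sub(1)])
    show "L2_set (\<lambda>i. norm (coord (h r) i)) F \<le> \<phi> r" if "r \<in> {s..t}" for r
      using h_le[of r] L2_set_coord_le_norm[OF F, of "h r"] that sub by auto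
  qed
  ultimately show "L2_set (\<lambda>i. norm (coord (ell2_integral h t - ell2_integral h s) i)) F
      \<le> integral {0..t} \<phi> - integral {0..s} \<phi>"
    by simp
qed

lemma continuous_on_ell2_integral: "continuous_on {0..T} (ell2_integral h)"
  unfolding continuous_on_iff
proof (intro ballI allI impI)
  fix t :: real and e :: real assume t: "t \<in> {0..T}" and e: "e > 0"
  have "continuous_on {0..T} (\<lambda>t. integral {0..t} \<phi>)"
    by (rule indefinite_integral_continuous_1[OF \<phi>])
  then obtain d where d: "d > 0"
    "\<And>s. s \<in> {0..T} \<Longrightarrow> dist s t < d \<Longrightarrow> dist (integral {0..s} \<phi>) (integral {0..t} \<phi>) < e"
    using t e unfolding continuous_on_iff by blast
  have "dist (ell2_integral h s) (ell2_integral h t) < e" if "s \<in> {0..T}" "dist s t < d" for s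
  proof -
    have "dist (ell2_integral h s) (ell2_integral h t) \<le> dist (integral {0..s} \<phi>) (integral {0..t} \<phi>)"
      using norm_ell2_integral_diff_le[of s t] norm_ell2_integral_diff_le[of t s] that t
      by (cases s t rule: le_cases) (auto simp: dist_norm norm_minus_commute)
    with d(2)[OF that] show ?thesis by simp
  qed
  then show "\<exists>d>0. \<forall>s\<in>{0..T}. dist s t < d \<longrightarrow> dist (ell2_integral h s) (ell2_integral h t) < e"
    using d(1) by blast
qed

end

section \<open>Convolution estimates\<close>

definition weight :: "int \<Rightarrow> real" where
  "weight k = 1 + (of_int k)\<^sup>2"

lemma weight_ge_1 [simp]: "1 \<le> weight k"
  and weight_pos [simp]: "0 < weight k"
  and weight_nonneg [simp]: "0 \<le> weight k"
  and weight_ne_0 [simp]: "weight k \<noteq> 0"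
  unfolding weight_def by (auto simp: add_pos_nonneg add_nonneg_eq_0_iff)

lemma weight_uminus [simp]: "weight (- k) = weight k"
  by (simp add: weight_def)

text \<open>Peetre's inequality on the integers, with \<open>k = j + (k - j)\<close>.\<close>

lemma weight_le_mult: "weight k \<le> 2 * weight j * weight (k - j)"
proof -
  define x y :: real where "x = of_int j" and "y = of_int (k - j)"
  \<comment> \<open>This sum of squares is exactly the difference of the two sides.\<close>
  have "0 \<le> (x - y)\<^sup>2 + 1 + 2 * (x * y)\<^sup>2"
    by simp
  then have "1 + (x + y)\<^sup>2 \<le> 2 * (1 + x\<^sup>2) * (1 + y\<^sup>2)"
    by (simp add: power2_eq_square algebra_simps)
  then show ?thesis
    unfolding weight_def x_def y_def by simp
qed

lemma weight_le_add: "weight k \<le> 2 * weight j + 2 * weight (k - j)"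
proof -
  define x y :: real where "x = of_int j" and "y = of_int (k - j)"
  have "0 \<le> (x - y)\<^sup>2"
    by simp
  then have "1 + (x + y)\<^sup>2 \<le> 2 * (1 + x\<^sup>2) + 2 * (1 + y\<^sup>2)"
    by (simp add: power2_eq_square algebra_simps)
  then show ?thesis
    unfolding weight_def x_def y_def by simp
qed

lemma weight_powr_summable:
  assumes "s > 1/2"
  shows "(\<lambda>k. weight k powr - s) summable_on UNIV"
proof -
  let ?f = "\<lambda>k. weight k powr - s"
  have "summable (\<lambda>n. of_nat n powr (- (2 * s)) :: real)"
    using assms by (simp add: summable_real_powr_iff)
  then have "summable (\<lambda>n. ?f (int n))"
  proof (rule summable_comparison_test_ev[rotated])
    \<comment> \<open>Only eventually: at \<open>n = 0\<close> the right-hand side is 0 by the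
      convention for \<open>powr\<close>, while the left-hand side is 1.\<close>
    show "\<forall>\<^sub>F n in sequentially. norm (?f (int n)) \<le> real n powr - (2 * s)"
      using eventually_gt_at_top[of 0]
    proof eventually_elim
      case (elim n)
      have "real n powr (2 * s) = (real n ^ 2) powr s"
        using elim by (simp add: powr_powr flip: powr_numeral)
      also have "\<dots> \<le> weight (int n) powr s"
        using assms by (intro powr_mono2) (auto simp: weight_def)
      finally show ?case
        using elim by (simp add: powr_minus le_imp_inverse_le)
    qed
  qed
  then have nat: "(\<lambda>n. ?f (int n)) summable_on UNIV"
    by (simp add: summable_on_UNIV_nonneg_real_iff)
  have pos: "?f summable_on range int"
    using nat by (subst summable_on_reindex) (auto simp: o_def)
  have neg: "?f summable_on range (\<lambda>n. - int n)"
    using nat by (subst summable_on_reindex) (auto simp: o_def inj_on_def)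
  have "UNIV = range int \<union> range (\<lambda>n. - int n)"
    by (metis (no_types, lifting) UNIV_eq_I UnCI int_cases2 rangeI)
  then show ?thesis
    using summable_on_union[OF pos neg] by simp
qed

definition unweight :: "real \<Rightarrow> (int, complex) ell2 \<Rightarrow> coeffs" where
  "unweight s a k = of_real (weight k powr (- s / 2)) * coord a k"

text \<open>What remains of the three weights when a product of functions is expressed through
  weighted coefficients (\<open>weighted_conv_altdef\<close>). Product estimates in the Sobolev
  scale become bounds on this kernel.\<close>

definition conv_kernel :: "real \<Rightarrow> int \<Rightarrow> int \<Rightarrow> real" where
  "conv_kernel s k j = weight k powr (s / 2) * weight j powr (- s / 2) * weight (k - j) powr (- s / 2)"

text \<open>The values are bare coefficient sequences because for small \<open>s\<close> only
  boundedness in \<open>k\<close> can be expected; at \<open>s = 0\<close> a product of two square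
  integrable functions is merely integrable.\<close>

definition weighted_conv :: "real \<Rightarrow> (int, complex) ell2 \<Rightarrow> (int, complex) ell2 \<Rightarrow> coeffs" where
  "weighted_conv s a b k = of_real (weight k powr (s / 2)) * conv (unweight s a) (unweight s b) k"

lemma conv_kernel_nonneg [simp]: "0 \<le> conv_kernel s k j"
  by (simp add: conv_kernel_def)

lemma conv_kernel_le:
  assumes "0 \<le> s"
  shows "conv_kernel s k j \<le> 2 powr (s / 2)"
proof -
  have "weight k powr (s / 2) \<le> (2 * weight j * weight (k - j)) powr (s / 2)"
    using assms weight_le_mult by (intro powr_mono2) auto
  also have "\<dots> = 2 powr (s / 2) * weight j powr (s / 2) * weight (k - j) powr (s / 2)"
    by (simp add: powr_mult)
  finally show ?thesis
    by (simp add: conv_kernel_def powr_minus field_simps)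
qed

lemma powr_sq: "(x powr r)\<^sup>2 = x powr (2 * r)" for x r :: real
  by (simp add: power2_eq_square flip: powr_add)

text \<open>Unlike the uniform bound \<open>conv_kernel_le\<close>, this one can be summed over
  \<open>j\<close>, with a result independent of \<open>k\<close>, once
  \<open>s > 1/2\<close>.\<close>

lemma conv_kernel_sq_le:
  assumes "0 \<le> s"
  shows "(conv_kernel s k j)\<^sup>2 \<le> 4 powr s * (weight j powr - s + weight (k - j) powr - s)"
proof -
  \<comment> \<open>Going through the maximum distributes the power over the sum without separating
    the concave case \<open>s \<le> 1\<close> from the convex one.\<close>
  have "weight k \<le> 4 * max (weight j) (weight (k - j))"
    using weight_le_add[of k j] by linarith
  then have "weight k powr s \<le> (4 * max (weight j) (weight (k - j))) powr s"
    using assms by (intro powr_mono2) auto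
  also have "\<dots> = 4 powr s * max (weight j) (weight (k - j)) powr s"
    by (simp add: powr_mult max_def)
  also have "\<dots> \<le> 4 powr s * (weight j powr s + weight (k - j) powr s)"
    by (intro mult_left_mono) (auto simp: max_def)
  finally have *: "weight k powr s \<le> 4 powr s * (weight j powr s + weight (k - j) powr s)" .
  have "(conv_kernel s k j)\<^sup>2 = weight k powr s * weight j powr - s * weight (k - j) powr - s"
    unfolding conv_kernel_def power_mult_distrib by (simp add: powr_sq)
  also have "\<dots> = weight k powr s / (weight j powr s * weight (k - j) powr s)"
    by (simp add: powr_minus field_simps)
  also have "\<dots> \<le> 4 powr s * (weight j powr s + weight (k - j) powr s) / (weight j powr s * weight (k - j) powr s)"
    using * by (intro divide_right_mono) auto
  also have "\<dots> = 4 powr s * (weight j powr - s + weight (k - j) powr - s)"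
    by (simp add: powr_minus field_simps)
  finally show ?thesis .
qed

lemma L2_set_reflect_le_norm:
  fixes b :: "(int, 'a::real_normed_vector) ell2"
  assumes "finite J"
  shows "L2_set (\<lambda>j. norm (coord b (k - j))) J \<le> norm b"
proof -
  have "L2_set (\<lambda>j. norm (coord b (k - j))) J = L2_set (\<lambda>j. norm (coord b j)) ((\<lambda>j. k - j) ` J)"
    unfolding L2_set_def by (subst sum.reindex) (auto simp: inj_on_def)
  also have "\<dots> \<le> norm b"
    using assms by (intro L2_set_coord_le_norm) auto
  finally show ?thesis .
qed

lemma sum_coord_prod_le:
  fixes a b :: "(int, complex) ell2"
  assumes "finite J"
  shows "(\<Sum>j\<in>J. cmod (coord a j) * cmod (coord b (k - j))) \<le> norm a * norm b"
proof -
  have "(\<Sum>j\<in>J. cmod (coord a j) * cmod (coord b (k - j)))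
      \<le> L2_set (\<lambda>j. cmod (coord a j)) J * L2_set (\<lambda>j. cmod (coord b (k - j))) J"
    using L2_set_mult_ineq[of "\<lambda>j. cmod (coord a j)" "\<lambda>j. cmod (coord b (k - j))" J] by simp
  also have "\<dots> \<le> norm a * norm b"
    using assms by (intro mult_mono L2_set_coord_le_norm L2_set_reflect_le_norm) auto
  finally show ?thesis .
qed

lemma coord_prod_summable:
  fixes a b :: "(int, complex) ell2"
  shows "(\<lambda>j. cmod (coord a j) * cmod (coord b (k - j))) summable_on UNIV"
  by (rule nonneg_bdd_above_summable_on)
     (auto intro!: bdd_aboveI[where M = "norm a * norm b"] sum_coord_prod_le)

lemma weighted_conv_altdef:
  "weighted_conv s a b k =
    (\<Sum>\<^sub>\<infinity>j. of_real (conv_kernel s k j) * (coord a j * coord b (k - j)))"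
  unfolding weighted_conv_def conv_def unweight_def conv_kernel_def
  by (subst infsum_cmult_right'[symmetric]) (simp add: mult_ac)

lemma weighted_conv_term_le:
  assumes "0 \<le> s"
  shows "cmod (of_real (conv_kernel s k j) * (coord a j * coord b (k - j)))
    \<le> 2 powr (s / 2) * (cmod (coord a j) * cmod (coord b (k - j)))"
  unfolding norm_mult norm_of_real
  by (intro mult_right_mono) (auto simp: conv_kernel_le[OF assms])

lemma weighted_conv_summable:
  fixes a b :: "(int, complex) ell2"
  assumes "0 \<le> s"
  shows "(\<lambda>j. of_real (conv_kernel s k j) * (coord a j * coord b (k - j))) summable_on UNIV"
proof (rule Infinite_Sum.abs_summable_summable, rule Infinite_Sum.abs_summable_on_comparison_test')
  show "(\<lambda>j. 2 powr (s / 2) * (cmod (coord a j) * cmod (coord b (k - j)))) summable_on UNIV"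
    by (intro summable_on_cmult_right coord_prod_summable)
qed (rule weighted_conv_term_le[OF assms])

lemma weighted_conv_le:
  assumes "0 \<le> s"
  shows "cmod (weighted_conv s a b k) \<le> 2 powr (s / 2) * (norm a * norm b)"
proof -
  have "cmod (weighted_conv s a b k)
      \<le> (\<Sum>\<^sub>\<infinity>j. 2 powr (s / 2) * (cmod (coord a j) * cmod (coord b (k - j))))"
    unfolding weighted_conv_altdef
    by (rule norm_infsum_le[OF has_sum_infsum[OF weighted_conv_summable[OF assms]] has_sum_infsum])
       (auto intro!: summable_on_cmult_right coord_prod_summable weighted_conv_term_le[OF assms])
  also have "\<dots> = 2 powr (s / 2) * (\<Sum>\<^sub>\<infinity>j. cmod (coord a j) * cmod (coord b (k - j)))"
    by (rule infsum_cmult_right')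
  also have "\<dots> \<le> 2 powr (s / 2) * (norm a * norm b)"
    by (intro mult_left_mono infsum_le_finite_sums coord_prod_summable sum_coord_prod_le) auto
  finally show ?thesis .
qed

lemma weighted_conv_add_left:
  "0 \<le> s \<Longrightarrow> weighted_conv s (a + a') b k = weighted_conv s a b k + weighted_conv s a' b k"
  unfolding weighted_conv_altdef
  by (simp add: distrib_left distrib_right infsum_add weighted_conv_summable)

lemma weighted_conv_add_right:
  "0 \<le> s \<Longrightarrow> weighted_conv s a (b + b') k = weighted_conv s a b k + weighted_conv s a b' k"
  unfolding weighted_conv_altdef
  by (simp add: distrib_left distrib_right infsum_add weighted_conv_summable)

lemma weighted_conv_scaleR:
  "weighted_conv s (r *\<^sub>R a) b k = r *\<^sub>R weighted_conv s a b k"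
  "weighted_conv s a (r *\<^sub>R b) k = r *\<^sub>R weighted_conv s a b k"
  unfolding weighted_conv_altdef
  by (simp_all add: mult_ac flip: infsum_scaleR_right)

text \<open>The operator (I - d_x^2)^{-1} d_x applied to a product, in weighted coefficients. The
  plain product is \<open>conv_ell2\<close>, which is square summable only under the stronger
  assumption on \<open>s\<close>.\<close>

definition conv_deriv :: "real \<Rightarrow> (int, complex) ell2 \<Rightarrow> (int, complex) ell2 \<Rightarrow> (int, complex) ell2" where
  "conv_deriv s a b = Abs_ell2 (\<lambda>k. \<i> * of_int k / of_real (weight k) * weighted_conv s a b k)"

definition conv_ell2 :: "real \<Rightarrow> (int, complex) ell2 \<Rightarrow> (int, complex) ell2 \<Rightarrow> (int, complex) ell2" where
  "conv_ell2 s a b = Abs_ell2 (weighted_conv s a b)"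

text \<open>The multiplier is at most \<open>weight k powr (-1/2)\<close> in size, so against the
  uniform bound on \<open>weighted_conv\<close> it remains to sum \<open>weight k powr -1\<close>,
  the exponent 1 case of \<open>weight_powr_summable\<close>.\<close>

lemma conv_deriv:
  assumes "0 \<le> s"
  shows "coord (conv_deriv s a b) k = \<i> * of_int k / of_real (weight k) * weighted_conv s a b k"
    "norm (conv_deriv s a b) \<le> norm a * norm b * (2 powr (s / 2) * sqrt (\<Sum>\<^sub>\<infinity>k. weight k powr -1))"
proof -
  define C where "C = 2 powr (s / 2) * (norm a * norm b)"
  have "L2_set (\<lambda>k. cmod (\<i> * of_int k / of_real (weight k) * weighted_conv s a b k)) F
      \<le> norm a * norm b * (2 powr (s / 2) * sqrt (\<Sum>\<^sub>\<infinity>k. weight k powr -1))" if F: "finite F" for F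
  proof -
    have "L2_set (\<lambda>k. cmod (\<i> * of_int k / of_real (weight k) * weighted_conv s a b k)) F
        \<le> L2_set (\<lambda>k. C * sqrt (weight k powr -1)) F"
    proof (rule L2_set_mono)
      fix k
      have "\<bar>of_int k\<bar> / weight k \<le> sqrt (weight k) / weight k"
        by (intro divide_right_mono real_le_rsqrt) (auto simp: weight_def)
      also have "\<dots> = sqrt (weight k powr -1)"
        by (simp add: powr_minus real_sqrt_inverse sqrt_divide_self_eq)
      finally have "\<bar>of_int k\<bar> / weight k \<le> sqrt (weight k powr -1)" .
      from mult_mono[OF this weighted_conv_le[OF assms, of a b k, folded C_def]]
      show "cmod (\<i> * of_int k / of_real (weight k) * weighted_conv s a b k) \<le> C * sqrt (weight k powr -1)"
        by (simp add: norm_mult norm_divide mult.commute)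
    qed simp
    also have "\<dots> = C * sqrt (\<Sum>k\<in>F. weight k powr -1)"
      using L2_set_right_distrib[of C "\<lambda>k. sqrt (weight k powr -1)" F]
      by (simp add: L2_set_def C_def)
    also have "\<dots> \<le> C * sqrt (\<Sum>\<^sub>\<infinity>k. weight k powr -1)"
      using F by (intro mult_left_mono real_sqrt_le_mono finite_sum_le_infsum weight_powr_summable) (auto simp: C_def)
    finally show ?thesis
      by (simp add: C_def mult_ac)
  qed
  from coord_Abs_ell2_if_bounded[OF this]
  show "coord (conv_deriv s a b) k = \<i> * of_int k / of_real (weight k) * weighted_conv s a b k"
    "norm (conv_deriv s a b) \<le> norm a * norm b * (2 powr (s / 2) * sqrt (\<Sum>\<^sub>\<infinity>k. weight k powr -1))"
    unfolding conv_deriv_def by simp_all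
qed

lemma bounded_bilinear_conv_deriv:
  assumes s: "0 \<le> s"
  shows "bounded_bilinear (conv_deriv s)"
proof (rule bounded_bilinear.intro)
  show "\<exists>K. \<forall>a b. norm (conv_deriv s a b) \<le> norm a * norm b * K"
    using conv_deriv(2)[OF s] by blast
qed (use s in \<open>auto intro!: ell2_eqI
  simp: conv_deriv(1)[OF s] weighted_conv_add_left weighted_conv_add_right weighted_conv_scaleR
    scaleR_conv_of_real distrib_left\<close>)

lemma conv_kernel_sq_sum_le:
  assumes "s > 1/2" "finite J"
  shows "(\<Sum>j\<in>J. (conv_kernel s k j)\<^sup>2) \<le> 4 powr s * (2 * (\<Sum>\<^sub>\<infinity>j. weight j powr - s))"
proof -
  let ?Z = "\<Sum>\<^sub>\<infinity>j. weight j powr - s"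
  have le: "(\<Sum>j\<in>I. weight j powr - s) \<le> ?Z" if "finite I" for I
    using that assms by (intro finite_sum_le_infsum weight_powr_summable) auto
  have "(\<Sum>j\<in>J. weight (k - j) powr - s) = (\<Sum>j\<in>(\<lambda>j. k - j) ` J. weight j powr - s)"
    by (subst sum.reindex) (auto simp: inj_on_def)
  then have le': "(\<Sum>j\<in>J. weight (k - j) powr - s) \<le> ?Z"
    using le[of "(\<lambda>j. k - j) ` J"] \<open>finite J\<close> by simp
  have "(\<Sum>j\<in>J. (conv_kernel s k j)\<^sup>2)
      \<le> 4 powr s * (\<Sum>j\<in>J. weight j powr - s + weight (k - j) powr - s)"
    unfolding sum_distrib_left using assms by (intro sum_mono conv_kernel_sq_le) auto
  also have "\<dots> \<le> 4 powr s * (2 * ?Z)"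
    unfolding sum.distrib mult_2 by (intro mult_left_mono add_mono le le' \<open>finite J\<close>) simp
  finally show ?thesis .
qed

text \<open>The algebra property. Cauchy-Schwarz in \<open>j\<close> puts the kernel in one factor,
  whose square sum is bounded uniformly in \<open>k\<close>; the double sum of the other factor
  splits into the two squared norms after a shift of \<open>k\<close>.\<close>

lemma conv_ell2:
  assumes s: "s > 1/2"
  shows "coord (conv_ell2 s a b) k = weighted_conv s a b k"
    "norm (conv_ell2 s a b) \<le> norm a * norm b * sqrt (4 powr s * (2 * (\<Sum>\<^sub>\<infinity>j. weight j powr - s)))"
proof -
  define C where "C = 4 powr s * (2 * (\<Sum>\<^sub>\<infinity>j. weight j powr - s))"
  have C: "0 \<le> C"
    unfolding C_def by (intro mult_nonneg_nonneg infsum_nonneg) auto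
  define c where "c k j = of_real (conv_kernel s k j) * (coord a j * coord b (k - j))" for k j
  \<comment> \<open>Both sums are truncated, so that exchanging them is an exchange of finite sums.
    The bound does not depend on \<open>J\<close>, and the limit over \<open>J\<close> is taken
    afterwards for fixed \<open>F\<close>.\<close>
  have fin: "L2_set (\<lambda>k. cmod (\<Sum>j\<in>J. c k j)) F \<le> norm a * norm b * sqrt C"
    if F: "finite F" and J: "finite J" for F J
  proof -
    have "(cmod (\<Sum>j\<in>J. c k j))\<^sup>2 \<le> C * (\<Sum>j\<in>J. (cmod (coord a j) * cmod (coord b (k - j)))\<^sup>2)" for k
    proof -
      have "cmod (\<Sum>j\<in>J. c k j) \<le> (\<Sum>j\<in>J. conv_kernel s k j * (cmod (coord a j) * cmod (coord b (k - j))))"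
        unfolding c_def by (rule order.trans[OF norm_sum]) (simp add: norm_mult)
      then have "(cmod (\<Sum>j\<in>J. c k j))\<^sup>2
          \<le> (\<Sum>j\<in>J. conv_kernel s k j * (cmod (coord a j) * cmod (coord b (k - j))))\<^sup>2"
        by (rule power_mono) simp
      also have "\<dots> \<le> (\<Sum>j\<in>J. (conv_kernel s k j)\<^sup>2) * (\<Sum>j\<in>J. (cmod (coord a j) * cmod (coord b (k - j)))\<^sup>2)"
        by (rule Cauchy_Schwarz_ineq_sum)
      also have "\<dots> \<le> C * (\<Sum>j\<in>J. (cmod (coord a j) * cmod (coord b (k - j)))\<^sup>2)"
        unfolding C_def by (intro mult_right_mono conv_kernel_sq_sum_le s J sum_nonneg) auto
      finally show ?thesis .
    qed
    then have "(\<Sum>k\<in>F. (cmod (\<Sum>j\<in>J. c k j))\<^sup>2)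
        \<le> (\<Sum>k\<in>F. C * (\<Sum>j\<in>J. (cmod (coord a j) * cmod (coord b (k - j)))\<^sup>2))"
      by (rule sum_mono)
    also have "\<dots> = C * (\<Sum>j\<in>J. (cmod (coord a j))\<^sup>2 * (\<Sum>k\<in>F. (cmod (coord b (k - j)))\<^sup>2))"
      by (subst sum_distrib_left[symmetric], subst sum.swap) (simp add: sum_distrib_left power_mult_distrib)
    also have "\<dots> \<le> C * (\<Sum>j\<in>J. (cmod (coord a j))\<^sup>2 * (norm b)\<^sup>2)"
    proof (intro mult_left_mono sum_mono C)
      fix j
      have "(\<Sum>k\<in>F. (cmod (coord b (k - j)))\<^sup>2) = (\<Sum>k\<in>(\<lambda>k. k - j) ` F. (cmod (coord b k))\<^sup>2)"
        by (subst sum.reindex) (auto simp: inj_on_def)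
      also have "\<dots> \<le> (norm b)\<^sup>2"
        using L2_set_coord_le_norm[of "(\<lambda>k. k - j) ` F" b] F by (simp add: L2_set_def sqrt_le_D)
      finally show "(\<Sum>k\<in>F. (cmod (coord b (k - j)))\<^sup>2) \<le> (norm b)\<^sup>2" .
    qed auto
    also have "\<dots> \<le> C * ((norm a)\<^sup>2 * (norm b)\<^sup>2)"
      unfolding sum_distrib_right[symmetric]
      using L2_set_coord_le_norm[OF J, of a]
      by (intro mult_left_mono mult_right_mono C) (auto simp: L2_set_def sqrt_le_D)
    also have "\<dots> = (norm a * norm b * sqrt C)\<^sup>2"
      using C by (simp add: power_mult_distrib mult_ac)
    finally show ?thesis
      unfolding L2_set_def using C by (intro real_le_lsqrt) (auto simp: sum_nonneg)
  qed
  have "L2_set (\<lambda>k. cmod (weighted_conv s a b k)) F \<le> norm a * norm b * sqrt C" if F: "finite F" for F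
  proof (rule tendsto_upperbound)
    have "((\<lambda>J. \<Sum>j\<in>J. c k j) \<longlongrightarrow> weighted_conv s a b k) (finite_subsets_at_top UNIV)" for k
      unfolding weighted_conv_altdef c_def
      by (rule infsum_tendsto) (rule weighted_conv_summable, use s in simp)
    then show "((\<lambda>J. L2_set (\<lambda>k. cmod (\<Sum>j\<in>J. c k j)) F) \<longlongrightarrow>
        L2_set (\<lambda>k. cmod (weighted_conv s a b k)) F) (finite_subsets_at_top UNIV)"
      unfolding L2_set_def by (intro tendsto_intros)
    show "\<forall>\<^sub>F J in finite_subsets_at_top UNIV. L2_set (\<lambda>k. cmod (\<Sum>j\<in>J. c k j)) F \<le> norm a * norm b * sqrt C"
      by (rule eventually_finite_subsets_at_top_weakI) (auto intro: fin F)
  qed simp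
  from coord_Abs_ell2_if_bounded[OF this]
  show "coord (conv_ell2 s a b) k = weighted_conv s a b k"
    "norm (conv_ell2 s a b) \<le> norm a * norm b * sqrt (4 powr s * (2 * (\<Sum>\<^sub>\<infinity>j. weight j powr - s)))"
    unfolding conv_ell2_def C_def by simp_all
qed

lemma bounded_bilinear_conv_ell2:
  assumes s: "s > 1/2"
  shows "bounded_bilinear (conv_ell2 s)"
proof (rule bounded_bilinear.intro)
  show "\<exists>K. \<forall>a b. norm (conv_ell2 s a b) \<le> norm a * norm b * K"
    using conv_ell2(2)[OF s] by blast
qed (use s in \<open>auto intro!: ell2_eqI
  simp: conv_ell2(1)[OF s] weighted_conv_add_left weighted_conv_add_right weighted_conv_scaleR
    scaleR_conv_of_real distrib_left\<close>)

section \<open>The nonlinearity\<close>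

text \<open>This class is stable under bounded linear and bilinear maps, hence contains the
  polynomial nonlinearity, which is not globally Lipschitz.\<close>

definition lipschitz_on_bounded :: "('a::real_normed_vector \<Rightarrow> 'b::real_normed_vector) \<Rightarrow> bool" where
  "lipschitz_on_bounded f \<longleftrightarrow>
    (\<forall>R. \<exists>K\<ge>0. \<forall>x y. norm x \<le> R \<longrightarrow> norm y \<le> R \<longrightarrow> norm (f x - f y) \<le> K * norm (x - y))"

lemma lipschitz_on_bounded_linear:
  assumes "bounded_linear f"
  shows "lipschitz_on_bounded f"
proof -
  interpret bounded_linear f by fact
  obtain K where "K \<ge> 0" "\<And>x. norm (f x) \<le> K * norm x"
    using nonneg_bounded by (auto simp: mult.commute)
  then show ?thesis
    unfolding lipschitz_on_bounded_def by (metis diff)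
qed

lemma lipschitz_on_bounded_bilinear:
  assumes B: "bounded_bilinear B" and f: "lipschitz_on_bounded f" and g: "lipschitz_on_bounded g"
  shows "lipschitz_on_bounded (\<lambda>x. B (f x) (g x))"
  unfolding lipschitz_on_bounded_def
proof
  fix R :: real
  interpret bounded_bilinear B by fact
  obtain K where K: "K \<ge> 0" "\<And>a b. norm (B a b) \<le> norm a * norm b * K"
    using nonneg_bounded by blast
  \<comment> \<open>With a nonnegative radius the ball contains 0, so comparison with 0 bounds
    \<open>f\<close> and \<open>g\<close> on it by \<open>F\<close> and \<open>G\<close>.\<close>
  define R' where "R' = max R 0"
  obtain Kf where Kf: "Kf \<ge> 0" "\<And>x y. norm x \<le> R' \<Longrightarrow> norm y \<le> R' \<Longrightarrow> norm (f x - f y) \<le> Kf * norm (x - y)"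
    using f unfolding lipschitz_on_bounded_def by blast
  obtain Kg where Kg: "Kg \<ge> 0" "\<And>x y. norm x \<le> R' \<Longrightarrow> norm y \<le> R' \<Longrightarrow> norm (g x - g y) \<le> Kg * norm (x - y)"
    using g unfolding lipschitz_on_bounded_def by blast
  define F G where "F = norm (f 0) + Kf * R'" and "G = norm (g 0) + Kg * R'"
  have R': "0 \<le> R'"
    by (simp add: R'_def)
  have FG: "0 \<le> F" "0 \<le> G"
    unfolding F_def G_def using R' Kf Kg by auto
  have F: "norm (f x) \<le> F" if "norm x \<le> R'" for x
    using Kf(2)[OF that, of 0] R' mult_left_mono[OF that Kf(1)] norm_triangle_sub[of "f x" "f 0"]
    unfolding F_def by simp
  have G: "norm (g x) \<le> G" if "norm x \<le> R'" for x
    using Kg(2)[OF that, of 0] R' mult_left_mono[OF that Kg(1)] norm_triangle_sub[of "g x" "g 0"]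
    unfolding G_def by simp
  have "norm (B (f x) (g x) - B (f y) (g y)) \<le> ((Kf * G + F * Kg) * K) * norm (x - y)"
    if "norm x \<le> R'" "norm y \<le> R'" for x y
  proof -
    have "B (f x) (g x) - B (f y) (g y) = B (f x - f y) (g x) + B (f y) (g x - g y)"
      by (simp add: diff_left diff_right)
    also have "norm \<dots> \<le> norm (f x - f y) * norm (g x) * K + norm (f y) * norm (g x - g y) * K"
      by (rule order.trans[OF norm_triangle_ineq add_mono[OF K(2) K(2)]])
    also have "\<dots> \<le> (Kf * norm (x - y)) * G * K + F * (Kg * norm (x - y)) * K"
      using that K FG Kf(1) Kg(1) by (intro add_mono mult_mono Kf(2) Kg(2) F G) auto
    finally show ?thesis
      by (simp add: algebra_simps)
  qed
  moreover have "0 \<le> (Kf * G + F * Kg) * K"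
    using K FG Kf(1) Kg(1) by auto
  ultimately show "\<exists>K\<ge>0. \<forall>x y. norm x \<le> R \<longrightarrow> norm y \<le> R \<longrightarrow>
      norm (B (f x) (g x) - B (f y) (g y)) \<le> K * norm (x - y)"
    unfolding R'_def by (metis le_max_iff_disj)
qed

lemma lipschitz_on_bounded_linear_comp:
  assumes L: "bounded_linear L" and f: "lipschitz_on_bounded f"
  shows "lipschitz_on_bounded (\<lambda>x. L (f x))"
  unfolding lipschitz_on_bounded_def
proof
  fix R
  interpret bounded_linear L by fact
  obtain C where C: "C \<ge> 0" "\<And>x. norm (L x) \<le> C * norm x"
    using nonneg_bounded by (auto simp: mult.commute)
  obtain K where K: "K \<ge> 0" "\<And>x y. norm x \<le> R \<Longrightarrow> norm y \<le> R \<Longrightarrow> norm (f x - f y) \<le> K * norm (x - y)"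
    using f unfolding lipschitz_on_bounded_def by blast
  have "norm (L (f x) - L (f y)) \<le> (C * K) * norm (x - y)" if "norm x \<le> R" "norm y \<le> R" for x y
    using C(2)[of "f x - f y"] mult_left_mono[OF K(2)[OF that] C(1)] by (simp add: diff mult.assoc)
  then show "\<exists>K\<ge>0. \<forall>x y. norm x \<le> R \<longrightarrow> norm y \<le> R \<longrightarrow> norm (L (f x) - L (f y)) \<le> K * norm (x - y)"
    using C(1) K(1) by (intro exI[of _ "C * K"]) auto
qed

lemma lipschitz_on_bounded_continuous:
  fixes f :: "'a::real_normed_vector \<Rightarrow> 'b::real_normed_vector"
  assumes "lipschitz_on_bounded f"
  shows "continuous_on S f"
proof (rule continuous_at_imp_continuous_on, rule ballI)
  fix x :: 'a
  obtain K where K: "K \<ge> 0"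
    "\<And>y z. norm y \<le> norm x + 1 \<Longrightarrow> norm z \<le> norm x + 1 \<Longrightarrow> norm (f y - f z) \<le> K * norm (y - z)"
    using assms unfolding lipschitz_on_bounded_def by blast
  have "((\<lambda>y. f y - f x) \<longlongrightarrow> 0) (at x)"
  proof (rule Lim_null_comparison)
    have "\<forall>\<^sub>F y in at x. dist y x < 1"
      by (auto simp: eventually_at intro: exI[of _ 1])
    then show "\<forall>\<^sub>F y in at x. norm (f y - f x) \<le> K * norm (y - x)"
    proof eventually_elim
      case (elim y)
      then show ?case
        using norm_triangle_sub[of y x] by (intro K(2)) (auto simp: dist_norm)
    qed
    have "((\<lambda>y. K * norm (y - x)) \<longlongrightarrow> K * norm (x - x)) (at x)"
      by (intro tendsto_intros)
    then show "((\<lambda>y. K * norm (y - x)) \<longlongrightarrow> 0) (at x)" by simp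
  qed
  then show "isCont f x"
    by (simp add: isCont_def LIM_zero_iff)
qed

text \<open>The index is shifted: \<open>power_ell2 s n\<close> represents the power with exponent \<open>n + 1\<close>, because the
  constant function \<open>1\<close> and \<open>conv_ell2\<close> are not needed for \<open>p = 1\<close>, where \<open>s\<close> may be below \<open>1/2\<close>.\<close>
primrec power_ell2 :: "real \<Rightarrow> nat \<Rightarrow> (int, complex) ell2 \<Rightarrow> (int, complex) ell2" where
  "power_ell2 s 0 a = a"
| "power_ell2 s (Suc n) a = conv_ell2 s a (power_ell2 s n a)"

lemma conv_delta: "conv u (\<lambda>k. if k = 0 then 1 else 0) = u"
proof
  fix k
  have "conv u (\<lambda>k. if k = 0 then 1 else 0) k = (\<Sum>\<^sub>\<infinity>j\<in>{k}. u j)"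
    unfolding conv_def by (rule infsum_cong_neutral) auto
  then show "conv u (\<lambda>k. if k = 0 then 1 else 0) k = u k" by simp
qed

lemma unweight_power_ell2:
  assumes "n = 0 \<or> s > 1/2"
  shows "unweight s (power_ell2 s n a) = cpow (Suc n) (unweight s a)"
  using assms
proof (induction n)
  case 0
  show ?case by (simp add: conv_delta)
next
  case (Suc n)
  then have "unweight s (power_ell2 s n a) = cpow (Suc n) (unweight s a)" and s: "s > 1/2"
    by auto
  then have "unweight s (power_ell2 s (Suc n) a) k
      = of_real (weight k powr (- s / 2) * weight k powr (s / 2)) * cpow (Suc (Suc n)) (unweight s a) k" for k
    by (simp add: unweight_def[of s "conv_ell2 s a b" for b] conv_ell2 weighted_conv_def)
  then show ?case
    by (intro ext) (simp flip: powr_add)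
qed

lemma lipschitz_on_bounded_power_ell2:
  assumes "n = 0 \<or> s > 1/2"
  shows "lipschitz_on_bounded (power_ell2 s n)"
  using assms
proof (induction n)
  case 0
  then show ?case
    using lipschitz_on_bounded_linear[OF bounded_linear_ident] by simp
next
  case (Suc n)
  then show ?case
    using lipschitz_on_bounded_bilinear[OF bounded_bilinear_conv_ell2
      lipschitz_on_bounded_linear[OF bounded_linear_ident]] by simp
qed

definition fst_ell2 :: "('i, 'a::real_normed_vector \<times> 'b::real_normed_vector) ell2 \<Rightarrow> ('i, 'a) ell2" where
  "fst_ell2 z = Abs_ell2 (\<lambda>k. fst (coord z k))"

definition inl_ell2 :: "('i, 'a::real_normed_vector) ell2 \<Rightarrow> ('i, 'a \<times> 'b::real_normed_vector) ell2" where
  "inl_ell2 a = Abs_ell2 (\<lambda>k. (coord a k, 0))"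

lemma bounded_linear_ell2_comp:
  assumes m: "\<And>i. linear (m i)" and C: "\<And>i x. norm (m i x) \<le> C * norm x"
  shows "bounded_linear (\<lambda>z. Abs_ell2 (\<lambda>i. m i (coord z i)))"
proof -
  define L where "L z = Abs_ell2 (\<lambda>i. m i (coord z i))" for z
  have L: "coord (L z) i = m i (coord z i)" "norm (L z) \<le> \<bar>C\<bar> * norm z" for z i
    unfolding L_def using ell2_comp_bounded[of m C z] C by auto
  have "bounded_linear L"
    by (rule bounded_linear_intro[of _ "\<bar>C\<bar>"])
       (auto intro!: ell2_eqI simp: L linear_add[OF m] linear_scale[OF m] mult.commute)
  then show ?thesis
    unfolding L_def[abs_def] .
qed

lemma norm_fst_le_norm: "norm (fst z) \<le> norm z"
  by (cases z) (simp add: norm_fst_le)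

lemma coord_fst_ell2 [simp]: "coord (fst_ell2 z) k = fst (coord z k)"
  unfolding fst_ell2_def by (rule ell2_comp_bounded(1)[of "\<lambda>_. fst" 1]) (simp add: norm_fst_le_norm)

lemma coord_inl_ell2 [simp]: "coord (inl_ell2 a) k = (coord a k, 0)"
  unfolding inl_ell2_def by (rule ell2_comp_bounded(1)[of "\<lambda>_ x. (x, 0)" 1]) (simp add: norm_Pair)

lemma bounded_linear_fst_ell2: "bounded_linear fst_ell2"
  unfolding fst_ell2_def
  by (rule bounded_linear_ell2_comp[of "\<lambda>_. fst" 1])
     (simp_all add: norm_fst_le_norm linear_fst)

lemma bounded_linear_inl_ell2: "bounded_linear inl_ell2"
  unfolding inl_ell2_def
  by (rule bounded_linear_ell2_comp[of "\<lambda>_ x. (x, 0)" 1])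
     (auto simp: norm_Pair intro!: linearI)

text \<open>\<open>G\<close> in weighted coefficients. Because of the index shift
  \<open>power_ell2 s (p - 1)\<close> stands for the \<open>p\<close>-th power, and the last factor
  is multiplied in by the smoothing product \<open>conv_deriv\<close>; thus for \<open>p = 1\<close>
  the algebra property never enters.\<close>

definition nonlin :: "nat \<Rightarrow> real \<Rightarrow> (int, complex \<times> complex) ell2 \<Rightarrow> (int, complex \<times> complex) ell2" where
  "nonlin p s z = inl_ell2 ((1 / real (p + 1)) *\<^sub>R conv_deriv s (fst_ell2 z) (power_ell2 s (p - 1) (fst_ell2 z)))"

lemma lipschitz_on_bounded_nonlin:
  assumes "0 \<le> s" "p = 1 \<or> s > 1/2"
  shows "lipschitz_on_bounded (nonlin p s)"
proof -
  let ?N = "\<lambda>a. conv_deriv s a (power_ell2 s (p - 1) a)"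
  have "lipschitz_on_bounded ?N"
    by (rule lipschitz_on_bounded_bilinear[OF bounded_bilinear_conv_deriv[OF assms(1)]
      lipschitz_on_bounded_linear[OF bounded_linear_ident] lipschitz_on_bounded_power_ell2])
      (use assms(2) in auto)
  then have N: "lipschitz_on_bounded (\<lambda>a. inl_ell2 ((1 / real (p + 1)) *\<^sub>R ?N a) :: (int, complex \<times> complex) ell2)"
    by (rule lipschitz_on_bounded_linear_comp[OF bounded_linear_inl_ell2
      lipschitz_on_bounded_linear_comp[OF bounded_linear_scaleR_right]])
  show ?thesis
    unfolding lipschitz_on_bounded_def
  proof
    fix R
    obtain K where K: "K \<ge> 0" "\<And>x y. norm x \<le> R \<Longrightarrow> norm y \<le> R \<Longrightarrow>
        norm (inl_ell2 ((1 / real (p + 1)) *\<^sub>R ?N x) - inl_ell2 ((1 / real (p + 1)) *\<^sub>R ?N y) :: (int, complex \<times> complex) ell2)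
        \<le> K * norm (x - y)"
      using N unfolding lipschitz_on_bounded_def by blast
    have fst_le: "norm (fst_ell2 z) \<le> norm z" for z :: "(int, complex \<times> complex) ell2"
      using ell2_comp_bounded(2)[of "\<lambda>_. fst" 1 z] by (simp add: fst_ell2_def norm_fst_le_norm)
    have "norm (nonlin p s x - nonlin p s y) \<le> K * norm (x - y)" if "norm x \<le> R" "norm y \<le> R" for x y
    proof -
      have "norm (nonlin p s x - nonlin p s y) \<le> K * norm (fst_ell2 (x - y))"
        unfolding nonlin_def linear_diff[OF bounded_linear.linear[OF bounded_linear_fst_ell2]]
        by (rule K(2)[OF order.trans[OF fst_le that(1)] order.trans[OF fst_le that(2)]])
      also have "\<dots> \<le> K * norm (x - y)"
        by (intro mult_left_mono fst_le K(1))
      finally show ?thesis .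
    qed
    then show "\<exists>K\<ge>0. \<forall>x y. norm x \<le> R \<longrightarrow> norm y \<le> R \<longrightarrow> norm (nonlin p s x - nonlin p s y) \<le> K * norm (x - y)"
      using K(1) by blast
  qed
qed

lemma nonlin_0: "0 \<le> s \<Longrightarrow> nonlin p s 0 = 0"
  by (simp add: nonlin_def bounded_bilinear.zero_left[OF bounded_bilinear_conv_deriv]
      linear_0[OF bounded_linear.linear[OF bounded_linear_fst_ell2]]
      linear_0[OF bounded_linear.linear[OF bounded_linear_inl_ell2]])

lemma coord_nonlin:
  assumes "0 \<le> s" "p \<ge> 1" "p = 1 \<or> s > 1/2"
  shows "coord (nonlin p s z) k =
    (of_real (weight k powr (s / 2)) * fst (G_mode p (unweight s (fst_ell2 z)) k), 0)"
proof -
  have "unweight s (power_ell2 s (p - 1) (fst_ell2 z)) = cpow p (unweight s (fst_ell2 z))"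
    using unweight_power_ell2[of "p - 1" s] assms by auto
  then show ?thesis
    using assms(1) unfolding nonlin_def
    by (simp add: conv_deriv weighted_conv_def G_mode_def weight_def scaleR_conv_of_real mult_ac add_ac)
qed

section \<open>The linear propagator\<close>

text \<open>The dispersion relation: the square of \<open>modeA k\<close> is multiplication by
  \<open>- (freq k)\<^sup>2\<close>.\<close>

definition freq :: "int \<Rightarrow> real" where
  "freq k = of_int k / sqrt (weight k)"

lemma abs_freq_le: "\<bar>freq k\<bar> \<le> 1"
proof -
  have "\<bar>of_int k\<bar> \<le> sqrt (weight k)"
    by (rule real_le_rsqrt) (simp add: weight_def)
  then show ?thesis
    by (simp add: freq_def abs_divide)
qed

text \<open>In weighted coefficients \<open>A\<close> acts on the \<open>k\<close>-th mode as
  \<open>freq k\<close> times this map. Its square is -1, so \<open>rot\<close> is its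
  exponential.\<close>

definition iswap :: "complex \<times> complex \<Rightarrow> complex \<times> complex" where
  "iswap z = (\<i> * snd z, \<i> * fst z)"

definition rot :: "real \<Rightarrow> complex \<times> complex \<Rightarrow> complex \<times> complex" where
  "rot \<theta> z = cos \<theta> *\<^sub>R z + sin \<theta> *\<^sub>R iswap z"

lemma norm_iswap: "norm (iswap z) = norm z"
  by (simp add: iswap_def norm_prod_def norm_mult add.commute)

lemma linear_iswap: "linear iswap"
  by (rule linearI) (auto simp: iswap_def algebra_simps)

lemma linear_rot: "linear (rot \<theta>)"
  by (rule linearI)
     (auto simp: rot_def linear_add[OF linear_iswap] linear_scale[OF linear_iswap] algebra_simps)

lemma rot_0 [simp]: "rot 0 z = z"
  by (simp add: rot_def)

lemma rot_rot: "rot \<theta> (rot \<phi> z) = rot (\<theta> + \<phi>) z"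
proof -
  have "iswap (iswap z) = - z"
    by (simp add: iswap_def prod_eq_iff)
  then show ?thesis
    by (simp add: rot_def linear_add[OF linear_iswap] linear_scale[OF linear_iswap] cos_add sin_add
        algebra_simps)
qed

lemma norm_rot [simp]: "norm (rot \<theta> z) = norm z"
proof -
  \<comment> \<open>The inner product is the real one; the contributions of the two components
    cancel.\<close>
  have orth: "z \<bullet> iswap z = 0" "iswap z \<bullet> z = 0"
    by (simp_all add: iswap_def inner_prod_def inner_complex_def)
  have "(norm (rot \<theta> z))\<^sup>2 = (cos \<theta>)\<^sup>2 * (norm z)\<^sup>2 + (sin \<theta>)\<^sup>2 * (norm (iswap z))\<^sup>2"
    unfolding power2_norm_eq_inner rot_def
    by (simp add: inner_add_left inner_add_right orth power2_eq_square)
  also have "\<dots> = (norm z)\<^sup>2 * ((sin \<theta>)\<^sup>2 + (cos \<theta>)\<^sup>2)"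
    unfolding norm_iswap by (simp only: distrib_left mult.commute add.commute)
  finally show ?thesis
    by simp
qed

lemma norm_rot_diff_le: "norm (rot \<theta> z - rot \<phi> z) \<le> 2 * \<bar>\<theta> - \<phi>\<bar> * norm z"
proof -
  have "rot \<theta> z - rot \<phi> z = (cos \<theta> - cos \<phi>) *\<^sub>R z + (sin \<theta> - sin \<phi>) *\<^sub>R iswap z"
    by (simp add: rot_def algebra_simps)
  also have "norm \<dots> \<le> \<bar>cos \<theta> - cos \<phi>\<bar> * norm z + \<bar>sin \<theta> - sin \<phi>\<bar> * norm z"
    by (rule order.trans[OF norm_triangle_ineq]) (simp add: norm_iswap)
  also have "\<dots> \<le> \<bar>\<theta> - \<phi>\<bar> * norm z + \<bar>\<theta> - \<phi>\<bar> * norm z"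
  proof -
    have half: "\<bar>sin x\<bar> \<le> \<bar>x\<bar>" for x :: real
      by (rule abs_sin_x_le_abs_x)
    have "\<bar>cos \<theta> - cos \<phi>\<bar> \<le> 2 * \<bar>sin ((\<theta> + \<phi>) / 2)\<bar> * \<bar>sin ((\<phi> - \<theta>) / 2)\<bar>"
      unfolding cos_diff_cos by (simp add: abs_mult)
    also have "\<dots> \<le> 2 * 1 * \<bar>(\<phi> - \<theta>) / 2\<bar>"
      by (intro mult_mono half) auto
    finally have c: "\<bar>cos \<theta> - cos \<phi>\<bar> \<le> \<bar>\<theta> - \<phi>\<bar>" by simp
    have "\<bar>sin \<theta> - sin \<phi>\<bar> \<le> 2 * \<bar>sin ((\<theta> - \<phi>) / 2)\<bar> * \<bar>cos ((\<theta> + \<phi>) / 2)\<bar>"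
      unfolding sin_diff_sin by (simp add: abs_mult)
    also have "\<dots> \<le> 2 * \<bar>(\<theta> - \<phi>) / 2\<bar> * 1"
      by (intro mult_mono half) auto
    finally have "\<bar>sin \<theta> - sin \<phi>\<bar> \<le> \<bar>\<theta> - \<phi>\<bar>" by simp
    with c show ?thesis
      by (intro add_mono mult_right_mono) auto
  qed
  finally show ?thesis by (simp add: mult_ac)
qed

definition propagator :: "real \<Rightarrow> (int, complex \<times> complex) ell2 \<Rightarrow> (int, complex \<times> complex) ell2" where
  "propagator t z = Abs_ell2 (\<lambda>k. rot (freq k * t) (coord z k))"

lemma coord_propagator [simp]: "coord (propagator t z) k = rot (freq k * t) (coord z k)"
  unfolding propagator_def by (rule ell2_comp_bounded(1)[of "\<lambda>k. rot (freq k * t)" 1]) simp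

lemma bounded_linear_propagator: "bounded_linear (propagator t)"
  unfolding propagator_def
  by (rule bounded_linear_ell2_comp[of "\<lambda>k. rot (freq k * t)" 1]) (auto intro: linear_rot)

lemma propagator_0 [simp]: "propagator 0 z = z"
  by (rule ell2_eqI) simp

lemma propagator_propagator: "propagator t (propagator r z) = propagator (t + r) z"
  by (rule ell2_eqI) (simp add: rot_rot distrib_left)

lemma propagator_diff: "propagator t (x - y) = propagator t x - propagator t y"
  by (rule linear_diff[OF bounded_linear.linear[OF bounded_linear_propagator]])

lemma norm_propagator [simp]: "norm (propagator t z) = norm z"
  by (simp add: norm_ell2.rep_eq)

text \<open>As all frequencies are bounded by 1, the generator is bounded and the group is
  continuous in operator norm. Together with isometry this gives joint continuity in time and
  state.\<close>

lemma norm_propagator_diff_le: "norm (propagator t z - propagator r z) \<le> 2 * \<bar>t - r\<bar> * norm z"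
proof -
  have "norm (rot (freq k * t) x - rot (freq k * r) x) \<le> (2 * \<bar>t - r\<bar>) * norm x" for k x
  proof -
    have "\<bar>freq k * t - freq k * r\<bar> = \<bar>freq k\<bar> * \<bar>t - r\<bar>"
      by (simp flip: right_diff_distrib abs_mult)
    also have "\<dots> \<le> \<bar>t - r\<bar>"
      using mult_right_mono[OF abs_freq_le[of k], of "\<bar>t - r\<bar>"] by simp
    finally show ?thesis
      by (intro order.trans[OF norm_rot_diff_le] mult_right_mono) auto
  qed
  from ell2_comp_bounded[of "\<lambda>k x. rot (freq k * t) x - rot (freq k * r) x", OF this]
  have *: "coord (Abs_ell2 (\<lambda>k. rot (freq k * t) (coord z k) - rot (freq k * r) (coord z k))) k
       = rot (freq k * t) (coord z k) - rot (freq k * r) (coord z k)"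
    "norm (Abs_ell2 (\<lambda>k. rot (freq k * t) (coord z k) - rot (freq k * r) (coord z k)))
       \<le> 2 * \<bar>t - r\<bar> * norm z" for k
    by auto
  moreover have "propagator t z - propagator r z
      = Abs_ell2 (\<lambda>k. rot (freq k * t) (coord z k) - rot (freq k * r) (coord z k))"
    by (rule ell2_eqI) (simp add: *(1))
  ultimately show ?thesis by simp
qed

lemma continuous_on_propagator:
  assumes "continuous_on A f" "continuous_on A g"
  shows "continuous_on A (\<lambda>t. propagator (g t) (f t))"
  unfolding continuous_on
proof
  fix t assume t: "t \<in> A"
  have f: "(f \<longlongrightarrow> f t) (at t within A)" and g: "(g \<longlongrightarrow> g t) (at t within A)"
    using assms t by (auto simp: continuous_on)
  have "((\<lambda>r. propagator (g r) (f r) - propagator (g t) (f t)) \<longlongrightarrow> 0) (at t within A)"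
  proof (rule Lim_null_comparison)
    show "\<forall>\<^sub>F r in at t within A. norm (propagator (g r) (f r) - propagator (g t) (f t))
        \<le> norm (f r - f t) + 2 * \<bar>g r - g t\<bar> * norm (f t)"
    proof (rule always_eventually, rule allI)
      fix r
      have "propagator (g r) (f r) - propagator (g t) (f t)
          = propagator (g r) (f r - f t) + (propagator (g r) (f t) - propagator (g t) (f t))"
        by (simp add: propagator_diff)
      also have "norm \<dots> \<le> norm (f r - f t) + 2 * \<bar>g r - g t\<bar> * norm (f t)"
        by (rule order.trans[OF norm_triangle_ineq add_mono]) (auto intro: norm_propagator_diff_le)
      finally show "norm (propagator (g r) (f r) - propagator (g t) (f t))
        \<le> norm (f r - f t) + 2 * \<bar>g r - g t\<bar> * norm (f t)" .
    qed
    have "((\<lambda>r. norm (f r - f t) + 2 * \<bar>g r - g t\<bar> * norm (f t))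
        \<longlongrightarrow> norm (f t - f t) + 2 * \<bar>g t - g t\<bar> * norm (f t)) (at t within A)"
      by (intro tendsto_intros f g)
    then show "((\<lambda>r. norm (f r - f t) + 2 * \<bar>g r - g t\<bar> * norm (f t)) \<longlongrightarrow> 0) (at t within A)"
      by simp
  qed
  then show "((\<lambda>t. propagator (g t) (f t)) \<longlongrightarrow> propagator (g t) (f t)) (at t within A)"
    by (simp add: LIM_zero_iff)
qed

section \<open>Weighted Fourier modes and the exponential series of A\<close>

definition mode_scale :: "real \<Rightarrow> int \<Rightarrow> complex \<times> complex \<Rightarrow> complex \<times> complex" where
  "mode_scale s k z = (of_real (weight k powr (s / 2)) * fst z, of_real (weight k powr ((s - 1) / 2)) * snd z)"

lemma bounded_linear_mode_scale: "bounded_linear (mode_scale s k)"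
  unfolding mode_scale_def by (intro bounded_linear_Pair bounded_linear_mult_const bounded_linear_const_mult
      bounded_linear_fst bounded_linear_snd)

lemma mode_scale_eq_iff [simp]: "mode_scale s k z = mode_scale s k w \<longleftrightarrow> z = w"
  by (auto simp: mode_scale_def prod_eq_iff)

lemma norm_mode_scale_sq:
  "(norm (mode_scale s k z))\<^sup>2 = weight k powr s * (cmod (fst z))\<^sup>2 + weight k powr (s - 1) * (cmod (snd z))\<^sup>2"
  by (simp add: mode_scale_def norm_prod_def norm_mult power_mult_distrib powr_sq diff_divide_distrib)

text \<open>\<open>modeA k\<close> sends \<open>z\<close> to \<open>freq k\<close> times
  \<open>q\<close> and \<open>q\<close> to \<open>- freq k\<close> times \<open>z\<close>. Naming
  \<open>q\<close> directly avoids dividing by \<open>freq k\<close>, which vanishes at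
  \<open>k = 0\<close>. The exponents of -1 are shaped like those in \<open>cos_coeff\<close> and
  \<open>sin_coeff\<close>.\<close>

lemma funpow_modeA:
  fixes k z
  defines "q \<equiv> (\<i> * snd z / of_real (sqrt (weight k)), \<i> * of_real (sqrt (weight k)) * fst z)"
  shows "(modeA k ^^ n) z = freq k ^ n *\<^sub>R
    (if even n then (-1) ^ (n div 2) *\<^sub>R z else (-1) ^ ((n - Suc 0) div 2) *\<^sub>R q)"
proof (induction n)
  case 0
  show ?case by simp
next
  case (Suc n)
  have scale: "modeA k (c *\<^sub>R x) = c *\<^sub>R modeA k x" for c x
    by (simp add: modeA_def scaleR_conv_of_real mult_ac)
  have weight: "1 + (of_int k)\<^sup>2 = (of_real (weight k) :: complex)"
    by (simp add: weight_def)
  have weight': "of_real (weight k) = (of_real (sqrt (weight k)) :: complex) * of_real (sqrt (weight k))"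
    unfolding of_real_mult[symmetric] by simp
  have z: "modeA k z = freq k *\<^sub>R q"
    unfolding modeA_def freq_def q_def weight
    by (simp add: scaleR_conv_of_real weight' prod_eq_iff field_simps)
  have q: "modeA k q = freq k *\<^sub>R (- z)"
    unfolding modeA_def freq_def q_def weight
    by (simp add: scaleR_conv_of_real weight' prod_eq_iff field_simps)
  show ?case
  proof (cases "even n")
    case True
    then show ?thesis
      using Suc by (simp add: scale z)
  next
    case False
    then obtain m where "n = 2 * m + 1" by (elim oddE)
    then show ?thesis
      using Suc by (simp add: scale q)
  qed
qed

lemma expA_mode_eq:
  "expA_mode k t z = cos (freq k * t) *\<^sub>R z +
    sin (freq k * t) *\<^sub>R (\<i> * snd z / of_real (sqrt (weight k)), \<i> * of_real (sqrt (weight k)) * fst z)"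
    (is "_ = _ *\<^sub>R z + _ *\<^sub>R ?q")
proof -
  have "(t ^ n / fact n) *\<^sub>R (modeA k ^^ n) z
      = (cos_coeff n *\<^sub>R (freq k * t) ^ n) *\<^sub>R z + (sin_coeff n *\<^sub>R (freq k * t) ^ n) *\<^sub>R ?q" for n
    unfolding funpow_modeA cos_coeff_def sin_coeff_def
    by (cases "even n") (simp_all add: power_mult_distrib mult_ac zero_prod_def)
  moreover have "(\<lambda>n. (cos_coeff n *\<^sub>R (freq k * t) ^ n) *\<^sub>R z + (sin_coeff n *\<^sub>R (freq k * t) ^ n) *\<^sub>R ?q)
      sums (cos (freq k * t) *\<^sub>R z + sin (freq k * t) *\<^sub>R ?q)"
    by (intro sums_add sums_scaleR_left cos_converges sin_converges)
  ultimately show ?thesis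
    unfolding expA_mode_def by (simp add: sums_iff)
qed

text \<open>The weight exponents of the two components differ by 1/2, which absorbs the unbalanced
  factors \<open>sqrt (weight k)\<close> in \<open>expA_mode_eq\<close> and leaves the symmetric map
  \<open>iswap\<close>.\<close>

lemma mode_scale_expA_mode: "mode_scale s k (expA_mode k t z) = rot (freq k * t) (mode_scale s k z)"
proof -
  have "weight k powr (s / 2) = weight k powr ((s - 1) / 2 + 1 / 2)"
    by (simp add: field_simps)
  also have "\<dots> = weight k powr ((s - 1) / 2) * sqrt (weight k)"
    by (simp only: powr_add powr_half_sqrt[OF weight_nonneg])
  finally have p: "weight k powr (s / 2) = weight k powr ((s - 1) / 2) * sqrt (weight k)" .
  show ?thesis
    unfolding expA_mode_eq rot_def
    by (simp add: mode_scale_def iswap_def p scaleR_conv_of_real algebra_simps)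
qed

definition to_ell2 :: "real \<Rightarrow> state \<Rightarrow> (int, complex \<times> complex) ell2" where
  "to_ell2 s U = Abs_ell2 (\<lambda>k. mode_scale s k (fst U k, snd U k))"

definition of_ell2 :: "real \<Rightarrow> (int, complex \<times> complex) ell2 \<Rightarrow> state" where
  "of_ell2 s z = ((\<lambda>k. of_real (weight k powr (- s / 2)) * fst (coord z k)),
     (\<lambda>k. of_real (weight k powr (- (s - 1) / 2)) * snd (coord z k)))"

lemma Hs_iff: "c \<in> Hs s \<longleftrightarrow> (\<forall>k. c (- k) = cnj (c k)) \<and> (\<lambda>k. weight k powr s * (cmod (c k))\<^sup>2) summable_on UNIV"
  by (simp add: Hs_def weight_def)

lemma Hnorm_sq: "(Hnorm s c)\<^sup>2 = (\<Sum>\<^sub>\<infinity>k. weight k powr s * (cmod (c k))\<^sup>2)"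
  unfolding Hnorm_def weight_def by (simp add: infsum_nonneg)

lemma Hnorm_nonneg [simp]: "0 \<le> Hnorm s c"
  by (simp add: Hnorm_def infsum_nonneg)

lemma to_ell2:
  assumes "U \<in> Xs s"
  shows "coord (to_ell2 s U) k = mode_scale s k (fst U k, snd U k)" "norm (to_ell2 s U) = Xnorm s U"
proof -
  have sum: "(\<lambda>k. weight k powr s * (cmod (fst U k))\<^sup>2) summable_on UNIV"
    "(\<lambda>k. weight k powr (s - 1) * (cmod (snd U k))\<^sup>2) summable_on UNIV"
    using assms by (auto simp: Xs_def Hs_iff)
  then have "sq_summable (\<lambda>k. mode_scale s k (fst U k, snd U k))"
    unfolding sq_summable_def norm_mode_scale_sq by (simp add: summable_on_add)
  then have c: "coord (to_ell2 s U) k = mode_scale s k (fst U k, snd U k)" for k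
    by (simp add: to_ell2_def Abs_ell2_inverse)
  then show "coord (to_ell2 s U) k = mode_scale s k (fst U k, snd U k)" .
  show "norm (to_ell2 s U) = Xnorm s U"
    unfolding norm_ell2.rep_eq Xnorm_def c norm_mode_scale_sq Hnorm_sq
    by (simp add: infsum_add sum)
qed

lemma mode_scale_of_ell2 [simp]: "mode_scale s k (fst (of_ell2 s z) k, snd (of_ell2 s z) k) = coord z k"
  by (simp add: mode_scale_def of_ell2_def mult.assoc[symmetric] prod_eq_iff add_divide_distrib[symmetric]
      flip: powr_add of_real_mult)

lemma of_ell2_to_ell2:
  assumes "U \<in> Xs s"
  shows "of_ell2 s (to_ell2 s U) = U"
proof -
  have "mode_scale s k (fst (of_ell2 s (to_ell2 s U)) k, snd (of_ell2 s (to_ell2 s U)) k) = mode_scale s k (fst U k, snd U k)" for k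
    by (simp only: mode_scale_of_ell2 to_ell2(1)[OF assms])
  then have "fst (of_ell2 s (to_ell2 s U)) k = fst U k \<and> snd (of_ell2 s (to_ell2 s U)) k = snd U k" for k
    by (simp only: mode_scale_eq_iff prod.inject)
  then show ?thesis
    by (simp add: prod_eq_iff fun_eq_iff)
qed

lemma fst_of_ell2: "fst (of_ell2 s z) = unweight s (fst_ell2 z)"
  by (simp add: of_ell2_def unweight_def fun_eq_iff)

lemma stdiff_Xs:
  assumes "U \<in> Xs s" "V \<in> Xs s"
  shows "stdiff U V \<in> Xs s" "to_ell2 s (stdiff U V) = to_ell2 s U - to_ell2 s V"
proof -
  have Hs_diff: "(\<lambda>k. a k - b k) \<in> Hs r" if "a \<in> Hs r" "b \<in> Hs r" for a b r
  proof -
    have "(\<lambda>k. weight k powr r * (cmod (a k - b k))\<^sup>2) summable_on UNIV"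
    proof (rule summable_on_comparison_test)
      show "(\<lambda>k. 2 * (weight k powr r * (cmod (a k))\<^sup>2) + 2 * (weight k powr r * (cmod (b k))\<^sup>2)) summable_on UNIV"
        using that by (intro summable_on_add summable_on_cmult_right) (auto simp: Hs_iff)
      fix k
      have "(cmod (a k - b k))\<^sup>2 \<le> (cmod (a k) + cmod (b k))\<^sup>2"
        by (intro power_mono norm_triangle_ineq4) simp
      also have "\<dots> \<le> 2 * (cmod (a k))\<^sup>2 + 2 * (cmod (b k))\<^sup>2"
        using sum_squares_bound[of "cmod (a k)" "cmod (b k)"] by (simp add: power2_sum)
      finally show "weight k powr r * (cmod (a k - b k))\<^sup>2
          \<le> 2 * (weight k powr r * (cmod (a k))\<^sup>2) + 2 * (weight k powr r * (cmod (b k))\<^sup>2)"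
        using mult_left_mono[of _ _ "weight k powr r"] by (fastforce simp: algebra_simps)
    qed simp
    then show ?thesis
      using that by (simp add: Hs_iff)
  qed
  show *: "stdiff U V \<in> Xs s"
    using assms by (auto simp: Xs_def stdiff_def intro: Hs_diff)
  show "to_ell2 s (stdiff U V) = to_ell2 s U - to_ell2 s V"
    by (rule ell2_eqI) (simp add: to_ell2[OF *] to_ell2[OF assms(1)] to_ell2[OF assms(2)],
        simp add: stdiff_def mode_scale_def algebra_simps)
qed

lemma Xnorm_stdiff:
  "U \<in> Xs s \<Longrightarrow> V \<in> Xs s \<Longrightarrow> Xnorm s (stdiff U V) = norm (to_ell2 s U - to_ell2 s V)"
  using stdiff_Xs[of U s V] to_ell2(2)[of "stdiff U V" s] by simp

text \<open>Complex conjugation of the underlying functions; its fixed points are the sequences of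
  real-valued pairs, which \<open>of_ell2_Xs\<close> carries back to \<open>Xs s\<close>.\<close>

definition conj_ell2 :: "(int, complex \<times> complex) ell2 \<Rightarrow> (int, complex \<times> complex) ell2" where
  "conj_ell2 z = Abs_ell2 (\<lambda>k. (cnj (fst (coord z (- k))), cnj (snd (coord z (- k)))))"

lemma conj_ell2:
  "coord (conj_ell2 z) k = (cnj (fst (coord z (- k))), cnj (snd (coord z (- k))))"
  "norm (conj_ell2 z) \<le> norm z"
proof -
  have "L2_set (\<lambda>k. norm (cnj (fst (coord z (- k))), cnj (snd (coord z (- k))))) F \<le> norm z"
    if "finite F" for F
    using L2_set_reflect_le_norm[OF that, of z 0] by (simp add: norm_prod_def)
  from coord_Abs_ell2_if_bounded[OF this]
  show "coord (conj_ell2 z) k = (cnj (fst (coord z (- k))), cnj (snd (coord z (- k))))"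
    "norm (conj_ell2 z) \<le> norm z"
    unfolding conj_ell2_def by simp_all
qed

lemma bounded_linear_conj_ell2: "bounded_linear conj_ell2"
  by (rule bounded_linear_intro[of _ 1]) (auto intro!: ell2_eqI simp: conj_ell2)

text \<open>Under \<open>k\<close> to \<open>- k\<close> the sine changes sign, and so does
  \<open>\<i>\<close> under conjugation; the two signs cancel.\<close>

lemma conj_ell2_propagator: "conj_ell2 (propagator t z) = propagator t (conj_ell2 z)"
  by (rule ell2_eqI) (simp add: conj_ell2 rot_def iswap_def freq_def scaleR_conv_of_real)

lemma conj_ell2_to_ell2: "U \<in> Xs s \<Longrightarrow> conj_ell2 (to_ell2 s U) = to_ell2 s U"
  by (rule ell2_eqI) (auto simp: conj_ell2 to_ell2 mode_scale_def Xs_def Hs_iff)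

lemma cnj_conv: "cnj (conv a b (- k)) = conv (\<lambda>j. cnj (a (- j))) (\<lambda>j. cnj (b (- j))) k"
proof -
  have "cnj (conv a b (- k)) = (\<Sum>\<^sub>\<infinity>j. cnj (a j) * cnj (b (- k - j)))"
    by (simp add: conv_def flip: infsum_cnj)
  also have "\<dots> = (\<Sum>\<^sub>\<infinity>j. cnj (a (- j)) * cnj (b (- (k - j))))"
    by (rule infsum_reindex_bij_witness[of _ uminus uminus]) auto
  finally show ?thesis
    by (simp add: conv_def)
qed

lemma cnj_cpow: "cnj (cpow n u (- k)) = cpow n (\<lambda>j. cnj (u (- j))) k"
proof (induction n arbitrary: k)
  case (Suc n)
  show ?case
    by (simp add: cnj_conv Suc)
qed simp

lemma conj_ell2_nonlin:
  assumes "0 \<le> s" "p \<ge> 1" "p = 1 \<or> s > 1/2"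
  shows "conj_ell2 (nonlin p s z) = nonlin p s (conj_ell2 z)"
proof (rule ell2_eqI)
  fix k
  have u: "unweight s (fst_ell2 (conj_ell2 z)) = (\<lambda>j. cnj (unweight s (fst_ell2 z) (- j)))"
    by (simp add: unweight_def conj_ell2 fun_eq_iff)
  show "coord (conj_ell2 (nonlin p s z)) k = coord (nonlin p s (conj_ell2 z)) k"
    by (simp del: cpow.simps add: conj_ell2 coord_nonlin[OF assms] G_mode_def u cnj_cpow)
qed

lemma of_ell2_Xs:
  assumes "conj_ell2 z = z"
  shows "of_ell2 s z \<in> Xs s" "to_ell2 s (of_ell2 s z) = z"
proof -
  have cnj: "coord z (- k) = (cnj (fst (coord z k)), cnj (snd (coord z k)))" for k
    using conj_ell2(1)[of z "- k", unfolded assms minus_minus] .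
  have sum: "(\<lambda>k. (norm (coord z k))\<^sup>2) summable_on UNIV"
    using coord_sq_summable[of z] by (simp add: sq_summable_def)
  have eq: "(norm (coord z k))\<^sup>2 = weight k powr s * (cmod (fst (of_ell2 s z) k))\<^sup>2
      + weight k powr (s - 1) * (cmod (snd (of_ell2 s z) k))\<^sup>2" for k
    using norm_mode_scale_sq[of s k "(fst (of_ell2 s z) k, snd (of_ell2 s z) k)"] by simp
  have le: "weight k powr s * (cmod (fst (of_ell2 s z) k))\<^sup>2 \<le> (norm (coord z k))\<^sup>2"
    "weight k powr (s - 1) * (cmod (snd (of_ell2 s z) k))\<^sup>2 \<le> (norm (coord z k))\<^sup>2" for k
    unfolding eq by simp_all
  have "(\<lambda>k. weight k powr s * (cmod (fst (of_ell2 s z) k))\<^sup>2) summable_on UNIV"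
    by (rule summable_on_comparison_test[OF sum]) (simp_all only: le, simp)
  moreover have "(\<lambda>k. weight k powr (s - 1) * (cmod (snd (of_ell2 s z) k))\<^sup>2) summable_on UNIV"
    by (rule summable_on_comparison_test[OF sum]) (simp_all only: le, simp)
  moreover have "fst (of_ell2 s z) (- k) = cnj (fst (of_ell2 s z) k)"
    "snd (of_ell2 s z) (- k) = cnj (snd (of_ell2 s z) k)" for k
    by (simp_all add: of_ell2_def cnj)
  ultimately show X: "of_ell2 s z \<in> Xs s"
    by (simp add: Xs_def Hs_iff)
  show "to_ell2 s (of_ell2 s z) = z"
    by (rule ell2_eqI) (simp add: to_ell2[OF X])
qed

section \<open>The forcing term\<close>

definition forcing_term :: "real \<Rightarrow> coeffs \<Rightarrow> (int, complex \<times> complex) ell2" where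
  "forcing_term s g = to_ell2 s ((\<lambda>k. g k / of_real (weight k)), (\<lambda>_. 0))"

lemma F_mode_eq: "F_mode g k = (g k / of_real (weight k), 0)"
  by (simp add: F_mode_def weight_def)

lemma forcing_term_Xs:
  assumes "g \<in> Hs (s - 2)"
  shows "((\<lambda>k. g k / of_real (weight k)), (\<lambda>_. 0)) \<in> Xs s"
    "Xnorm s ((\<lambda>k. g k / of_real (weight k)), (\<lambda>_. 0)) = Hnorm (s - 2) g"
proof -
  have eq: "weight k powr s * (cmod (g k / of_real (weight k)))\<^sup>2 = weight k powr (s - 2) * (cmod (g k))\<^sup>2" for k
    by (simp add: norm_divide power_divide powr_diff)
  show "((\<lambda>k. g k / of_real (weight k)), (\<lambda>_. 0)) \<in> Xs s"
    using assms by (simp add: Xs_def Hs_iff eq)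
  have "Hnorm (s - 1) (\<lambda>_. 0) = 0"
    by (simp add: Hnorm_def)
  moreover have "(Hnorm s (\<lambda>k. g k / of_real (weight k)))\<^sup>2 = (Hnorm (s - 2) g)\<^sup>2"
    unfolding Hnorm_sq eq ..
  ultimately show "Xnorm s ((\<lambda>k. g k / of_real (weight k)), (\<lambda>_. 0)) = Hnorm (s - 2) g"
    by (simp add: Xnorm_def)
qed

lemma forcing_term:
  assumes "g \<in> Hs (s - 2)"
  shows "coord (forcing_term s g) k = mode_scale s k (F_mode g k)" "norm (forcing_term s g) = Hnorm (s - 2) g"
    "conj_ell2 (forcing_term s g) = forcing_term s g"
  using to_ell2[OF forcing_term_Xs(1)[OF assms]] forcing_term_Xs(2)[OF assms] conj_ell2_to_ell2[OF forcing_term_Xs(1)[OF assms]]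
  by (simp_all add: forcing_term_def F_mode_eq)

lemma forcing_term_diff:
  assumes "g \<in> Hs (s - 2)" "h \<in> Hs (s - 2)"
  shows "(\<lambda>k. g k - h k) \<in> Hs (s - 2)" "forcing_term s (\<lambda>k. g k - h k) = forcing_term s g - forcing_term s h"
proof -
  have "(g, \<lambda>_. 0) \<in> Xs (s - 2)" "(h, \<lambda>_. 0) \<in> Xs (s - 2)"
    using assms by (auto simp: Xs_def Hs_iff)
  from stdiff_Xs(1)[OF this] show "(\<lambda>k. g k - h k) \<in> Hs (s - 2)"
    by (simp add: stdiff_def Xs_def)
  show "forcing_term s (\<lambda>k. g k - h k) = forcing_term s g - forcing_term s h"
    using stdiff_Xs(2)[OF forcing_term_Xs(1)[OF assms(1)] forcing_term_Xs(1)[OF assms(2)]]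
    by (simp add: forcing_term_def stdiff_def diff_divide_distrib)
qed

section \<open>Integrability in time and the Duhamel integral of a single mode\<close>

lemma set_integrable_scaleR_bounded:
  fixes c :: "real \<Rightarrow> 'a::{banach, second_countable_topology}"
  assumes c: "set_integrable lborel A c" and [measurable]: "\<alpha> \<in> borel_measurable borel"
    and "\<And>r. \<bar>\<alpha> r\<bar> \<le> 1"
  shows "set_integrable lborel A (\<lambda>r. \<alpha> r *\<^sub>R c r)"
proof -
  have le: "norm (\<alpha> r *\<^sub>R x) \<le> norm x" for r and x :: 'a
    using mult_right_mono[OF assms(3), of "norm x" r] by simp
  have "integrable lborel (\<lambda>r. \<alpha> r *\<^sub>R (indicator A r *\<^sub>R c r))"
  proof (rule Bochner_Integration.integrable_bound)
    show "integrable lborel (\<lambda>r. indicator A r *\<^sub>R c r)"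
      using c by (simp add: set_integrable_def)
    then show "(\<lambda>r. \<alpha> r *\<^sub>R (indicator A r *\<^sub>R c r)) \<in> borel_measurable lborel"
      by measurable
    show "AE r in lborel. norm (\<alpha> r *\<^sub>R (indicator A r *\<^sub>R c r)) \<le> norm (indicator A r *\<^sub>R c r)"
      by (intro AE_I2 le)
  qed
  then show ?thesis
    by (simp add: set_integrable_def mult.commute)
qed

lemma set_integrable_bounded_linear:
  assumes "bounded_linear L" "set_integrable M A c"
  shows "set_integrable M A (\<lambda>r. L (c r))"
  using integrable_bounded_linear[OF assms(1), of M "\<lambda>r. indicator A r *\<^sub>R c r"] assms(2)
  by (simp add: set_integrable_def linear_scale[OF bounded_linear.linear[OF assms(1)]])

lemma bounded_linear_rot: "bounded_linear (rot \<theta>)"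
  using linear_rot by (simp add: linear_conv_bounded_linear)

lemma set_integrable_rot:
  fixes \<theta> :: "real \<Rightarrow> real"
  assumes c: "set_integrable lborel A c" and [measurable]: "\<theta> \<in> borel_measurable borel"
  shows "set_integrable lborel A (\<lambda>r. rot (\<theta> r) (c r))"
proof -
  have "bounded_linear iswap"
    using linear_iswap by (simp add: linear_conv_bounded_linear)
  from set_integrable_bounded_linear[OF this c]
  have "set_integrable lborel A (\<lambda>r. sin (\<theta> r) *\<^sub>R iswap (c r))"
    by (rule set_integrable_scaleR_bounded) auto
  moreover have "set_integrable lborel A (\<lambda>r. cos (\<theta> r) *\<^sub>R c r)"
    by (rule set_integrable_scaleR_bounded[OF c]) auto
  ultimately show ?thesis
    unfolding rot_def by (intro set_integral_add)
qed

lemma set_integrable_expA_mode: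
  assumes c: "set_integrable lborel {0..t} c"
  shows "set_integrable lborel {0..t} (\<lambda>r. expA_mode k (t - r) (c r))"
proof -
  define L :: "complex \<times> complex \<Rightarrow> complex \<times> complex"
    where "L z = (\<i> * snd z / of_real (sqrt (weight k)), \<i> * of_real (sqrt (weight k)) * fst z)" for z
  have "linear L"
    by (rule linearI) (simp_all add: L_def scaleR_conv_of_real distrib_left add_divide_distrib mult_ac)
  then have "bounded_linear L"
    by (simp add: linear_conv_bounded_linear)
  from set_integrable_bounded_linear[OF this c]
  have "set_integrable lborel {0..t} (\<lambda>r. sin (freq k * (t - r)) *\<^sub>R L (c r))"
    by (rule set_integrable_scaleR_bounded) auto
  moreover have "set_integrable lborel {0..t} (\<lambda>r. cos (freq k * (t - r)) *\<^sub>R c r)"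
    by (rule set_integrable_scaleR_bounded[OF c]) auto
  ultimately show ?thesis
    unfolding expA_mode_eq L_def[symmetric] by (intro set_integral_add)
qed

text \<open>The rotation by \<open>freq k * (t - r)\<close> factors into one that depends only on
  \<open>t\<close>, which leaves the integral, and one that depends only on \<open>r\<close>. The
  same statement serves the nonlinear term and the forcing.\<close>

lemma mode_scale_duhamel:
  assumes c: "set_integrable lborel {0..t} c"
  shows "mode_scale s k (LINT r:{0..t}|lborel. expA_mode k (t - r) (c r)) =
    rot (freq k * t) (integral {0..t} (\<lambda>r. rot (freq k * (- r)) (mode_scale s k (c r))))"
proof -
  have "set_integrable lborel {0..t} (\<lambda>r. rot (freq k * (- r)) (mode_scale s k (c r)))"
    by (intro set_integrable_rot set_integrable_bounded_linear[OF bounded_linear_mode_scale c]) simp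
  note int = set_borel_integral_eq_integral(1)[OF this]
  note e = set_integrable_expA_mode[OF c, of k]
  have "mode_scale s k (LINT r:{0..t}|lborel. expA_mode k (t - r) (c r))
      = integral {0..t} (\<lambda>r. mode_scale s k (expA_mode k (t - r) (c r)))"
    using integral_linear[OF set_borel_integral_eq_integral(1)[OF e] bounded_linear_mode_scale[of s k]]
    by (simp add: set_borel_integral_eq_integral(2)[OF e] o_def)
  also have "(\<lambda>r. mode_scale s k (expA_mode k (t - r) (c r)))
      = rot (freq k * t) \<circ> (\<lambda>r. rot (freq k * (- r)) (mode_scale s k (c r)))"
    by (simp add: fun_eq_iff mode_scale_expA_mode rot_rot algebra_simps)
  also have "integral {0..t} \<dots> = rot (freq k * t) (integral {0..t} (\<lambda>r. rot (freq k * (- r)) (mode_scale s k (c r))))"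
    by (rule integral_linear[OF int bounded_linear_rot])
  finally show ?thesis .
qed

lemma Cpath_iff:
  "Cpath s T U \<longleftrightarrow> (\<forall>t\<in>{0..T}. U t \<in> Xs s) \<and> continuous_on {0..T} (\<lambda>t. to_ell2 s (U t))"
  unfolding Cpath_def continuous_on_iff
  by (auto simp: dist_norm Xnorm_stdiff)

definition forcing :: "real \<Rightarrow> (real \<Rightarrow> coeffs) \<Rightarrow> real \<Rightarrow> (int, complex \<times> complex) ell2" where
  "forcing s f r = propagator (- r) (forcing_term s (f r))"

lemma set_integrable_F_mode:
  assumes "L1 s Ts f"
  shows "set_integrable lborel {0..Ts} (\<lambda>r. F_mode (f r) k)"
proof -
  have m [measurable]: "(\<lambda>r. indicator {0..Ts} r *\<^sub>R f r k) \<in> borel_measurable borel"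
    using assms by (auto simp: L1_def set_borel_measurable_def)
  have "set_integrable lborel {0..Ts} (\<lambda>r. Hnorm (s - 2) (f r))"
    using assms by (simp add: L1_def)
  then have H: "integrable lborel (\<lambda>r. weight k powr (- s / 2) * (indicator {0..Ts} r *\<^sub>R Hnorm (s - 2) (f r)))"
    unfolding set_integrable_def by (rule integrable_mult_right)
  have "integrable lborel (\<lambda>r. (indicator {0..Ts} r *\<^sub>R f r k / of_real (weight k), 0 :: complex))"
  proof (rule Bochner_Integration.integrable_bound[OF H])
    show "AE r in lborel. norm (indicator {0..Ts} r *\<^sub>R f r k / complex_of_real (weight k), 0 :: complex)
       \<le> norm (weight k powr (- s / 2) * (indicator {0..Ts} r *\<^sub>R Hnorm (s - 2) (f r)))"
    proof (rule AE_I2)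
      fix r
      show "norm (indicator {0..Ts} r *\<^sub>R f r k / complex_of_real (weight k), 0 :: complex)
         \<le> norm (weight k powr (- s / 2) * (indicator {0..Ts} r *\<^sub>R Hnorm (s - 2) (f r)))"
      proof (cases "r \<in> {0..Ts}")
        case True
        then have h: "f r \<in> Hs (s - 2)"
          using assms by (simp add: L1_def)
        \<comment> \<open>A single coordinate is bounded by the norm of the sequence, so the
          integrable norm of \<open>f\<close> dominates each mode.\<close>
        have "weight k powr (s / 2) * cmod (f r k / of_real (weight k)) \<le> Hnorm (s - 2) (f r)"
          using norm_coord_le[of "forcing_term s (f r)" k]
          unfolding forcing_term(1)[OF h] forcing_term(2)[OF h]
          by (simp add: mode_scale_def F_mode_eq norm_Pair norm_mult norm_divide)
        then have "cmod (f r k / of_real (weight k)) \<le> weight k powr (- s / 2) * Hnorm (s - 2) (f r)"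
          by (simp add: powr_minus field_simps)
        then show ?thesis
          using True abs_ge_self order.trans by (fastforce simp: norm_Pair)
      qed simp
    qed
  qed measurable
  moreover have "(indicator {0..Ts} r *\<^sub>R f r k / of_real (weight k), 0 :: complex) = indicator {0..Ts} r *\<^sub>R F_mode (f r) k" for r
    by (simp add: F_mode_eq scaleR_conv_of_real)
  ultimately show ?thesis
    unfolding set_integrable_def by simp
qed

lemma forcing_integrable:
  assumes f: "L1 s Ts f"
  shows "(\<lambda>r. coord (forcing s f r) k) integrable_on {0..Ts}"
    "(\<lambda>r. Hnorm (s - 2) (f r)) integrable_on {0..Ts}"
    "\<And>r. r \<in> {0..Ts} \<Longrightarrow> norm (forcing s f r) \<le> Hnorm (s - 2) (f r)"
proof -
  have h: "f r \<in> Hs (s - 2)" if "r \<in> {0..Ts}" for r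
    using f that by (simp add: L1_def)
  have "set_integrable lborel {0..Ts} (\<lambda>r. rot (freq k * (- r)) (mode_scale s k (F_mode (f r) k)))"
    by (intro set_integrable_rot set_integrable_bounded_linear[OF bounded_linear_mode_scale]
        set_integrable_F_mode[OF f]) simp
  from set_borel_integral_eq_integral(1)[OF this]
  show "(\<lambda>r. coord (forcing s f r) k) integrable_on {0..Ts}"
    by (rule integrable_eq) (simp add: forcing_def forcing_term(1)[OF h])
  show "(\<lambda>r. Hnorm (s - 2) (f r)) integrable_on {0..Ts}"
    using f by (intro set_borel_integral_eq_integral(1)) (simp add: L1_def)
  show "norm (forcing s f r) \<le> Hnorm (s - 2) (f r)" if "r \<in> {0..Ts}" for r
    using forcing_term(2)[OF h[OF that]] by (simp add: forcing_def)
qed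

lemma norm_forcing_integral_le:
  assumes f: "L1 s Ts f" and t: "t \<in> {0..Ts}"
  shows "norm (ell2_integral (forcing s f) t) \<le> L1norm s Ts f"
proof -
  have "norm (ell2_integral (forcing s f) t) \<le> integral {0..t} (\<lambda>r. Hnorm (s - 2) (f r))"
    by (rule coord_ell2_integral(2)[OF forcing_integrable[OF f] t])
  also have "\<dots> \<le> integral {0..Ts} (\<lambda>r. Hnorm (s - 2) (f r))"
    using t forcing_integrable(2)[OF f]
    by (intro integral_subset_le) (auto simp: Hnorm_def infsum_nonneg intro: integrable_on_subinterval)
  also have "\<dots> = L1norm s Ts f"
    using f unfolding L1norm_def by (subst set_borel_integral_eq_integral(2)) (auto simp: L1_def)
  finally show ?thesis .
qed

lemma conj_forcing_integral:
  assumes f: "L1 s Ts f" and t: "t \<in> {0..Ts}"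
  shows "conj_ell2 (ell2_integral (forcing s f) t) = ell2_integral (forcing s f) t"
proof (rule ell2_eqI)
  fix k
  define cj :: "complex \<times> complex \<Rightarrow> complex \<times> complex" where "cj z = (cnj (fst z), cnj (snd z))" for z
  have cj: "bounded_linear cj"
    unfolding cj_def
    by (intro bounded_linear_Pair bounded_linear_compose[OF bounded_linear_cnj]
        bounded_linear_fst bounded_linear_snd)
  have int: "(\<lambda>r. coord (forcing s f r) (- k)) integrable_on {0..t}"
    by (rule integrable_on_subinterval[OF forcing_integrable(1)[OF f]]) (use t in auto)
  have "coord (conj_ell2 (ell2_integral (forcing s f) t)) k = cj (integral {0..t} (\<lambda>r. coord (forcing s f r) (- k)))"
    using coord_ell2_integral(1)[OF forcing_integrable[OF f] t, of "- k"] by (simp add: conj_ell2 cj_def)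
  also have "\<dots> = integral {0..t} (\<lambda>r. cj (coord (forcing s f r) (- k)))"
    using integral_linear[OF int cj] by (simp add: o_def)
  also have "\<dots> = integral {0..t} (\<lambda>r. coord (forcing s f r) k)"
  proof (rule integral_cong)
    fix r assume "r \<in> {0..t}"
    then have "f r \<in> Hs (s - 2)"
      using f t by (simp add: L1_def)
    then have "conj_ell2 (forcing s f r) = forcing s f r"
      by (simp add: forcing_def conj_ell2_propagator forcing_term(3))
    then show "cj (coord (forcing s f r) (- k)) = coord (forcing s f r) k"
      using conj_ell2(1)[of "forcing s f r" k] by (simp add: cj_def)
  qed
  also have "\<dots> = coord (ell2_integral (forcing s f) t) k"
    using coord_ell2_integral(1)[OF forcing_integrable[OF f] t] by simp
  finally show "coord (conj_ell2 (ell2_integral (forcing s f) t)) k = coord (ell2_integral (forcing s f) t) k" .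
qed

text \<open>Enumerating the integers by \<open>int_decode\<close> turns the unordered sum into a
  series of measurable functions. This is what makes the norm of a difference of two forcings
  measurable.\<close>

lemma measurable_Hnorm:
  assumes f: "\<And>t. t \<in> A \<Longrightarrow> f t \<in> Hs s" and m: "\<And>k. set_borel_measurable lborel A (\<lambda>t. f t k)"
  shows "set_borel_measurable lborel A (\<lambda>t. Hnorm s (f t))"
proof -
  define g where "g n t = weight (int_decode n) powr s * (cmod (indicator A t *\<^sub>R f t (int_decode n)))\<^sup>2" for n t
  have [measurable]: "(\<lambda>t. indicator A t *\<^sub>R f t k) \<in> borel_measurable borel" for k
    using m by (simp add: set_borel_measurable_def)
  have [measurable]: "g n \<in> borel_measurable borel" for n
    unfolding g_def by measurable
  have "indicator A t *\<^sub>R Hnorm s (f t) = sqrt (\<Sum>n. g n t)" for t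
  proof (cases "t \<in> A")
    case True
    then have "(\<lambda>k. weight k powr s * (cmod (f t k))\<^sup>2) summable_on UNIV"
      using f by (simp add: Hs_iff)
    then have "((\<lambda>k. weight k powr s * (cmod (f t k))\<^sup>2) has_sum (Hnorm s (f t))\<^sup>2) UNIV"
      unfolding Hnorm_sq by (rule has_sum_infsum)
    then have "((\<lambda>n. weight (int_decode n) powr s * (cmod (f t (int_decode n)))\<^sup>2) has_sum (Hnorm s (f t))\<^sup>2) UNIV"
      by (subst has_sum_reindex_bij_betw[of int_decode UNIV UNIV]) (auto intro: bij_int_decode)
    then have "(\<lambda>n. g n t) sums (Hnorm s (f t))\<^sup>2"
      using True by (simp add: g_def has_sum_imp_sums)
    then show ?thesis
      using True by (simp add: sums_iff)
  qed (simp add: g_def)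
  then show ?thesis
    unfolding set_borel_measurable_def by simp
qed

lemma L1_fdiff:
  assumes g: "L1 s Ts g" and h: "L1 s Ts h"
  shows "L1 s Ts (fdiff g h)"
proof -
  have gh: "g t \<in> Hs (s - 2)" "h t \<in> Hs (s - 2)" if "t \<in> {0..Ts}" for t
    using assms that by (auto simp: L1_def)
  have d: "fdiff g h t \<in> Hs (s - 2)" if "t \<in> {0..Ts}" for t
    using forcing_term_diff(1)[OF gh[OF that]] by (simp add: fdiff_def)
  have m: "set_borel_measurable lborel {0..Ts} (\<lambda>t. fdiff g h t k)" for k
    using assms unfolding fdiff_def L1_def set_borel_measurable_def scaleR_diff_right
    by (intro borel_measurable_diff) auto
  have "set_integrable lborel {0..Ts} (\<lambda>t. Hnorm (s - 2) (g t) + Hnorm (s - 2) (h t))"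
    using assms by (intro set_integral_add) (auto simp: L1_def)
  then have "set_integrable lborel {0..Ts} (\<lambda>t. Hnorm (s - 2) (fdiff g h t))"
  proof (rule set_integrable_bound)
    show "set_borel_measurable lborel {0..Ts} (\<lambda>t. Hnorm (s - 2) (fdiff g h t))"
      by (rule measurable_Hnorm[OF d m])
    show "AE t in lborel. t \<in> {0..Ts} \<longrightarrow>
      norm (Hnorm (s - 2) (fdiff g h t)) \<le> norm (Hnorm (s - 2) (g t) + Hnorm (s - 2) (h t))"
    proof (intro AE_I2 impI)
      fix t assume t: "t \<in> {0..Ts}"
      have "Hnorm (s - 2) (fdiff g h t) = norm (forcing_term s (g t) - forcing_term s (h t))"
        using forcing_term(2)[OF d[OF t]] forcing_term_diff(2)[OF gh[OF t]] by (simp add: fdiff_def)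
      also have "\<dots> \<le> Hnorm (s - 2) (g t) + Hnorm (s - 2) (h t)"
        using norm_triangle_ineq4[of "forcing_term s (g t)" "forcing_term s (h t)"] gh[OF t] by (simp add: forcing_term(2))
      finally show "norm (Hnorm (s - 2) (fdiff g h t)) \<le> norm (Hnorm (s - 2) (g t) + Hnorm (s - 2) (h t))"
        by simp
    qed
  qed
  with d m show ?thesis
    by (simp add: L1_def)
qed

lemma L1norm_le_add_fdiff:
  assumes g: "L1 s Ts g" and h: "L1 s Ts h"
  shows "L1norm s Ts g \<le> L1norm s Ts h + L1norm s Ts (fdiff g h)"
proof -
  note d = L1_fdiff[OF g h]
  have int: "set_integrable lborel {0..Ts} (\<lambda>t. Hnorm (s - 2) (q t))" if "L1 s Ts q" for q
    using that by (simp add: L1_def)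
  have "L1norm s Ts g \<le> (LINT t:{0..Ts}|lborel. Hnorm (s - 2) (h t) + Hnorm (s - 2) (fdiff g h t))"
    unfolding L1norm_def
  proof (rule set_integral_mono)
    fix t assume "t \<in> {0..Ts}"
    then have gh: "g t \<in> Hs (s - 2)" "h t \<in> Hs (s - 2)" "fdiff g h t \<in> Hs (s - 2)"
      using g h d by (auto simp: L1_def)
    have "norm (forcing_term s (g t)) \<le> norm (forcing_term s (h t)) + norm (forcing_term s (g t) - forcing_term s (h t))"
      by (rule norm_triangle_sub)
    also have "forcing_term s (g t) - forcing_term s (h t) = forcing_term s (fdiff g h t)"
      using forcing_term_diff(2)[OF gh(1,2)] by (simp add: fdiff_def)
    finally show "Hnorm (s - 2) (g t) \<le> Hnorm (s - 2) (h t) + Hnorm (s - 2) (fdiff g h t)"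
      by (simp add: forcing_term(2) gh)
  qed (intro set_integral_add int g h d)+
  also have "\<dots> = L1norm s Ts h + L1norm s Ts (fdiff g h)"
    unfolding L1norm_def by (rule set_integral_add) (intro int h d)+
  finally show ?thesis .
qed

lemma forcing_integral_diff:
  assumes g: "L1 s Ts g" and h: "L1 s Ts h" and t: "t \<in> {0..Ts}"
  shows "norm (ell2_integral (forcing s g) t - ell2_integral (forcing s h) t) \<le> L1norm s Ts (fdiff g h)"
proof -
  note d = L1_fdiff[OF g h]
  have int: "(\<lambda>r. coord (forcing s q r) k) integrable_on {0..t}" if "L1 s Ts q" for q k
    by (rule integrable_on_subinterval[OF forcing_integrable(1)[OF that]]) (use t in auto)
  have c: "coord (ell2_integral (forcing s q) t) k = integral {0..t} (\<lambda>r. coord (forcing s q r) k)"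
    if "L1 s Ts q" for q k
    by (rule coord_ell2_integral(1)[OF forcing_integrable[OF that] t])
  have "ell2_integral (forcing s g) t - ell2_integral (forcing s h) t = ell2_integral (forcing s (fdiff g h)) t"
  proof (rule ell2_eqI)
    fix k
    have "integral {0..t} (\<lambda>r. coord (forcing s (fdiff g h) r) k)
        = integral {0..t} (\<lambda>r. coord (forcing s g r) k - coord (forcing s h r) k)"
    proof (rule integral_cong)
      fix r assume "r \<in> {0..t}"
      then have "g r \<in> Hs (s - 2)" "h r \<in> Hs (s - 2)"
        using g h t by (auto simp: L1_def)
      then have "forcing s (fdiff g h) r = forcing s g r - forcing s h r"
        using forcing_term_diff(2)[of "g r" s "h r"] by (simp add: forcing_def fdiff_def propagator_diff)
      then show "coord (forcing s (fdiff g h) r) k = coord (forcing s g r) k - coord (forcing s h r) k"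
        by simp
    qed
    then show "coord (ell2_integral (forcing s g) t - ell2_integral (forcing s h) t) k
        = coord (ell2_integral (forcing s (fdiff g h)) t) k"
      by (simp only: coord_simps c[OF g] c[OF h] c[OF d] integral_diff[OF int[OF g] int[OF h]])
  qed
  then show ?thesis
    using norm_forcing_integral_le[OF d t] by simp
qed

section \<open>Mild solutions\<close>

definition duhamel_data :: "real \<Rightarrow> state \<Rightarrow> (real \<Rightarrow> coeffs) \<Rightarrow> real \<Rightarrow> (int, complex \<times> complex) ell2" where
  "duhamel_data s U0 f t = to_ell2 s U0 + ell2_integral (forcing s f) t"

text \<open>The nonlinearity in the interaction picture. The minus sign of the Duhamel formula is
  included, so that the integral equation for \<open>profile\<close> carries a plus sign.\<close>

definition twisted :: "nat \<Rightarrow> real \<Rightarrow> real \<Rightarrow> (int, complex \<times> complex) ell2 \<Rightarrow> (int, complex \<times> complex) ell2" where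
  "twisted p s r x = - propagator (- r) (nonlin p s (propagator r x))"

definition profile :: "real \<Rightarrow> (real \<Rightarrow> state) \<Rightarrow> real \<Rightarrow> (int, complex \<times> complex) ell2" where
  "profile s U t = propagator (- t) (to_ell2 s (U t))"

lemma propagator_profile [simp]: "propagator t (profile s U t) = to_ell2 s (U t)"
  by (simp add: profile_def propagator_propagator)

lemma norm_profile: "U t \<in> Xs s \<Longrightarrow> norm (profile s U t) = Xnorm s (U t)"
  by (simp add: profile_def to_ell2)

lemma norm_profile_diff:
  "U t \<in> Xs s \<Longrightarrow> V t \<in> Xs s \<Longrightarrow> norm (profile s U t - profile s V t) = Xnorm s (stdiff (U t) (V t))"
  by (simp add: profile_def Xnorm_stdiff flip: propagator_diff)

lemma norm_twisted_diff_le: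
  "norm (nonlin p s (propagator r x) - nonlin p s (propagator r y)) \<le> K * norm (x - y) \<Longrightarrow>
    norm (twisted p s r x - twisted p s r y) \<le> K * norm (x - y)"
  by (simp add: twisted_def norm_minus_commute flip: propagator_diff)

context
  fixes p :: nat and s Ts :: real
  assumes s: "0 \<le> s" and p: "p \<ge> 1" and ps: "p = 1 \<or> s > 1/2"
begin

lemma continuous_on_nonlin: "continuous_on A y \<Longrightarrow> continuous_on A (\<lambda>r. nonlin p s (y r))"
  by (rule continuous_on_compose2[OF lipschitz_on_bounded_continuous[OF lipschitz_on_bounded_nonlin[OF s ps], of UNIV]])
     auto

lemma continuous_on_twisted:
  "continuous_on A y \<Longrightarrow> continuous_on A (\<lambda>r. twisted p s r (y r))"
  unfolding twisted_def
  by (intro continuous_on_minus continuous_on_propagator continuous_on_nonlin continuous_on_id)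

text \<open>Scaling the mode and cancelling the rotation by \<open>freq k * t\<close> are both
  injective, so nothing is lost in passing to \<open>profile\<close>. The integrability conditions
  of \<open>mild\<close> hold for every continuous path.\<close>

lemma mode_equation_iff:
  assumes U0: "U0 \<in> Xs s" and f: "L1 s Ts f" and T: "T \<le> Ts"
    and U: "\<And>t. t \<in> {0..T} \<Longrightarrow> U t \<in> Xs s" and cont: "continuous_on {0..T} (\<lambda>t. to_ell2 s (U t))"
    and t: "t \<in> {0..T}"
  shows "set_integrable lborel {0..t} (\<lambda>\<tau>. expA_mode k (t - \<tau>) (G_mode p (fst (U \<tau>)) k))" (is ?G)
    "set_integrable lborel {0..t} (\<lambda>\<tau>. expA_mode k (t - \<tau>) (F_mode (f \<tau>) k))" (is ?F)
    "(fst (U t) k, snd (U t) k) =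
       expA_mode k t (fst U0 k, snd U0 k)
       - (LINT \<tau>:{0..t}|lborel. expA_mode k (t - \<tau>) (G_mode p (fst (U \<tau>)) k))
       + (LINT \<tau>:{0..t}|lborel. expA_mode k (t - \<tau>) (F_mode (f \<tau>) k)) \<longleftrightarrow>
     coord (profile s U t) k =
       coord (duhamel_data s U0 f t + integral {0..t} (\<lambda>r. twisted p s r (profile s U r))) k"
    (is "?u = ?e - ?IG + ?IF \<longleftrightarrow> _")
proof -
  define Z where "Z t = to_ell2 s (U t)" for t
  have sub: "{0..t} \<subseteq> {0..T}" "{0..t} \<subseteq> {0..Ts}" and t': "t \<in> {0..Ts}"
    using t T by auto
  have Gc: "mode_scale s k (G_mode p (fst (U r)) k) = coord (nonlin p s (Z r)) k" if "r \<in> {0..T}" for r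
    using fst_of_ell2[of s "Z r"] of_ell2_to_ell2[OF U[OF that]]
    by (simp add: coord_nonlin[OF s p ps] mode_scale_def G_mode_def Z_def)
  have Z: "continuous_on {0..t} Z"
    unfolding Z_def by (rule continuous_on_subset[OF cont sub(1)])
  have N: "continuous_on {0..t} (\<lambda>r. propagator (- r) (nonlin p s (Z r)))"
    by (intro continuous_on_propagator continuous_on_nonlin Z continuous_intros)
  \<comment> \<open>Continuity in time of \<open>G_mode\<close>, an infinite sum, is read off from
    the continuity of \<open>nonlin\<close> by undoing the weight.\<close>
  have "continuous_on {0..t} (\<lambda>r. (of_real (weight k powr (- s / 2)) * fst (coord (nonlin p s (Z r)) k), 0 :: complex))"
    by (intro continuous_intros continuous_on_coord continuous_on_nonlin Z)
  moreover have "(of_real (weight k powr (- s / 2)) * fst (coord (nonlin p s (Z r)) k), 0 :: complex) = G_mode p (fst (U r)) k"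
    if "r \<in> {0..t}" for r
  proof -
    have "of_real (weight k powr (- s / 2)) * (of_real (weight k powr (s / 2)) * c) = c" for c :: complex
      by (simp add: powr_minus flip: mult.assoc of_real_mult)
    moreover have "fst (coord (nonlin p s (Z r)) k) = of_real (weight k powr (s / 2)) * fst (G_mode p (fst (U r)) k)"
      using Gc[of r] that sub by (auto simp: mode_scale_def prod_eq_iff)
    ultimately show ?thesis
      by (simp add: prod_eq_iff) (simp add: G_mode_def)
  qed
  ultimately have "continuous_on {0..t} (\<lambda>r. G_mode p (fst (U r)) k)"
    by (rule continuous_on_eq)
  then have G: "set_integrable lborel {0..t} (\<lambda>r. G_mode p (fst (U r)) k)"
    by (rule borel_integrable_atLeastAtMost')
  then show ?G
    by (rule set_integrable_expA_mode)
  have F: "set_integrable lborel {0..t} (\<lambda>r. F_mode (f r) k)"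
    by (rule set_integrable_subset[OF set_integrable_F_mode[OF f] _ sub(2)]) simp
  then show ?F
    by (rule set_integrable_expA_mode)
  have IG: "mode_scale s k ?IG = - rot (freq k * t) (coord (integral {0..t} (\<lambda>r. twisted p s r (profile s U r))) k)"
  proof -
    have "integral {0..t} (\<lambda>r. rot (freq k * - r) (mode_scale s k (G_mode p (fst (U r)) k)))
        = integral {0..t} (\<lambda>r. coord (propagator (- r) (nonlin p s (Z r))) k)"
      by (rule integral_cong) (use sub Gc in auto)
    also have "\<dots> = coord (integral {0..t} (\<lambda>r. propagator (- r) (nonlin p s (Z r)))) k"
      using integral_linear[OF integrable_continuous_interval[OF N] bounded_linear_coord[of k]]
      by (simp add: o_def)
    also have "integral {0..t} (\<lambda>r. propagator (- r) (nonlin p s (Z r)))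
        = - integral {0..t} (\<lambda>r. twisted p s r (profile s U r))"
      by (simp add: twisted_def Z_def)
    finally show ?thesis
      using mode_scale_duhamel[OF G, of s k] by (simp add: linear_neg[OF linear_rot])
  qed
  have IF: "mode_scale s k ?IF = rot (freq k * t) (coord (ell2_integral (forcing s f) t) k)"
  proof -
    have "integral {0..t} (\<lambda>r. rot (freq k * - r) (mode_scale s k (F_mode (f r) k)))
        = integral {0..t} (\<lambda>r. coord (forcing s f r) k)"
    proof (rule integral_cong)
      fix r assume "r \<in> {0..t}"
      then have "f r \<in> Hs (s - 2)"
        using f sub by (auto simp: L1_def)
      then show "rot (freq k * - r) (mode_scale s k (F_mode (f r) k)) = coord (forcing s f r) k"
        by (simp add: forcing_def forcing_term)
    qed
    then show ?thesis
      using mode_scale_duhamel[OF F, of s k] coord_ell2_integral(1)[OF forcing_integrable[OF f] t'] by simp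
  qed
  note lin = bounded_linear.linear[OF bounded_linear_mode_scale]
  define Y where "Y = duhamel_data s U0 f t + integral {0..t} (\<lambda>r. twisted p s r (profile s U r))"
  have rhs: "mode_scale s k (?e - ?IG + ?IF) = rot (freq k * t) (coord Y k)"
    unfolding linear_add[OF lin] linear_diff[OF lin] IG IF Y_def duhamel_data_def
    by (simp add: mode_scale_expA_mode linear_add[OF linear_rot] to_ell2[OF U0])
  have lhs: "mode_scale s k ?u = rot (freq k * t) (coord (profile s U t) k)"
    using to_ell2(1)[OF U[OF t], of k] coord_propagator[of t "profile s U t" k] by simp
  have inj: "rot (freq k * t) x = rot (freq k * t) y \<longleftrightarrow> x = y" for x y
    using rot_rot[of "- (freq k * t)" "freq k * t"] by (metis add.left_inverse rot_0)
  have "?u = ?e - ?IG + ?IF \<longleftrightarrow> mode_scale s k ?u = mode_scale s k (?e - ?IG + ?IF)"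
    by (rule mode_scale_eq_iff[symmetric])
  also have "\<dots> \<longleftrightarrow> coord (profile s U t) k = coord Y k"
    unfolding lhs rhs by (rule inj)
  finally show "?u = ?e - ?IG + ?IF \<longleftrightarrow> coord (profile s U t) k =
      coord (duhamel_data s U0 f t + integral {0..t} (\<lambda>r. twisted p s r (profile s U r))) k"
    unfolding Y_def .
qed

lemma mild_iff:
  assumes U0: "U0 \<in> Xs s" and f: "L1 s Ts f" and T: "T \<le> Ts"
  shows "mild p s T U0 f U \<longleftrightarrow>
    (\<forall>t\<in>{0..T}. U t \<in> Xs s) \<and> continuous_on {0..T} (\<lambda>t. to_ell2 s (U t)) \<and>
    (\<forall>t\<in>{0..T}. profile s U t =
      duhamel_data s U0 f t + integral {0..t} (\<lambda>r. twisted p s r (profile s U r)))"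
proof (cases "(\<forall>t\<in>{0..T}. U t \<in> Xs s) \<and> continuous_on {0..T} (\<lambda>t. to_ell2 s (U t))")
  case True
  then have U: "\<And>t. t \<in> {0..T} \<Longrightarrow> U t \<in> Xs s" and c: "continuous_on {0..T} (\<lambda>t. to_ell2 s (U t))"
    by auto
  note m = mode_equation_iff[OF U0 f T U c]
  have "mild p s T U0 f U \<longleftrightarrow> (\<forall>t\<in>{0..T}. \<forall>k. coord (profile s U t) k =
      coord (duhamel_data s U0 f t + integral {0..t} (\<lambda>r. twisted p s r (profile s U r))) k)"
    unfolding mild_def Cpath_iff using True m by (simp only: simp_thms ball_simps ball_triv cong: ball_cong)
  also have "\<dots> \<longleftrightarrow> (\<forall>t\<in>{0..T}. profile s U t =
      duhamel_data s U0 f t + integral {0..t} (\<lambda>r. twisted p s r (profile s U r)))"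
    by (intro ball_cong refl) (auto intro: ell2_eqI)
  finally show ?thesis
    using True by blast
next
  case False
  then show ?thesis
    by (auto simp: mild_def Cpath_iff)
qed

lemma continuous_on_profile:
  "continuous_on A (\<lambda>t. to_ell2 s (U t)) \<Longrightarrow> continuous_on A (profile s U)"
  unfolding profile_def by (intro continuous_on_propagator continuous_intros)

lemma continuous_on_duhamel_data:
  assumes "L1 s Ts f" "T \<le> Ts"
  shows "continuous_on {0..T} (duhamel_data s U0 f)"
  unfolding duhamel_data_def
  by (intro continuous_intros continuous_on_subset[OF continuous_on_ell2_integral[OF forcing_integrable[OF assms(1)]]])
     (use assms(2) in auto)

text \<open>The bound \<open>R\<close> on both solutions supplies the ball on which \<open>K\<close>
  is a Lipschitz constant; as the propagator is isometric, differences of profiles measure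
  differences of solutions.\<close>

lemma mild_stability:
  assumes K: "0 \<le> K"
    "\<And>x y. norm x \<le> R \<Longrightarrow> norm y \<le> R \<Longrightarrow> norm (nonlin p s x - nonlin p s y) \<le> K * norm (x - y)"
    and T: "T \<le> Ts"
    and V: "V0 \<in> Xs s" "L1 s Ts g" "mild p s T V0 g V" "\<And>t. t \<in> {0..T} \<Longrightarrow> Xnorm s (V t) \<le> R"
    and W: "W0 \<in> Xs s" "L1 s Ts h" "mild p s T W0 h W" "\<And>t. t \<in> {0..T} \<Longrightarrow> Xnorm s (W t) \<le> R"
    and t: "t \<in> {0..T}"
  shows "Xnorm s (stdiff (V t) (W t))
    \<le> 2 * exp (2 * K * T) * (Xnorm s (stdiff V0 W0) + L1norm s Ts (fdiff g h))"
proof -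
  note V' = V(3)[unfolded mild_iff[OF V(1,2) T]] and W' = W(3)[unfolded mild_iff[OF W(1,2) T]]
  have Vc: "continuous_on {0..T} (profile s V)" and Wc: "continuous_on {0..T} (profile s W)"
    using V' W' by (auto intro: continuous_on_profile)
  have "norm (profile s V t - profile s W t)
      \<le> 2 * (Xnorm s (stdiff V0 W0) + L1norm s Ts (fdiff g h)) * exp (2 * K * T)"
  proof (rule integral_equation_stability[where M = "twisted p s", OF K(1) Vc Wc _ _ _ _ _ _ t])
    show "continuous_on {0..T} (\<lambda>t. twisted p s t (profile s V t))"
      "continuous_on {0..T} (\<lambda>t. twisted p s t (profile s W t))"
      by (intro continuous_on_twisted Vc Wc)+
    fix r assume r: "r \<in> {0..T}"
    then have r': "r \<in> {0..Ts}" and VW: "V r \<in> Xs s" "W r \<in> Xs s"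
      using T V' W' by auto
    show "norm (twisted p s r (profile s V r) - twisted p s r (profile s W r))
        \<le> K * norm (profile s V r - profile s W r)"
      using V(4)[OF r] W(4)[OF r] VW by (intro norm_twisted_diff_le)
         (simp add: norm_profile_diff Xnorm_stdiff K(2) to_ell2)
    show "profile s V r = duhamel_data s V0 g r + integral {0..r} (\<lambda>r. twisted p s r (profile s V r))"
      using V' r by blast
    show "profile s W r = duhamel_data s W0 h r + integral {0..r} (\<lambda>r. twisted p s r (profile s W r))"
      using W' r by blast
    have "duhamel_data s V0 g r - duhamel_data s W0 h r = (to_ell2 s V0 - to_ell2 s W0)
        + (ell2_integral (forcing s g) r - ell2_integral (forcing s h) r)"
      by (simp add: duhamel_data_def)
    also have "norm \<dots> \<le> Xnorm s (stdiff V0 W0) + L1norm s Ts (fdiff g h)"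
      unfolding Xnorm_stdiff[OF V(1) W(1)]
      by (rule order.trans[OF norm_triangle_ineq])
         (intro add_mono forcing_integral_diff[OF V(2) W(2) r'] order.refl)
    finally show "norm (duhamel_data s V0 g r - duhamel_data s W0 h r)
        \<le> Xnorm s (stdiff V0 W0) + L1norm s Ts (fdiff g h)" .
  qed
  moreover have "V t \<in> Xs s" "W t \<in> Xs s"
    using V' W' t by auto
  ultimately show ?thesis
    by (simp add: norm_profile_diff algebra_simps)
qed

lemma mild_bounded:
  assumes "mild p s T U0 f U"
  shows "\<exists>R. \<forall>t\<in>{0..T}. Xnorm s (U t) \<le> R"
proof -
  have U: "\<forall>t\<in>{0..T}. U t \<in> Xs s" and "continuous_on {0..T} (\<lambda>t. to_ell2 s (U t))"
    using assms by (auto simp: mild_def Cpath_iff)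
  then have "bounded ((\<lambda>t. to_ell2 s (U t)) ` {0..T})"
    by (intro compact_imp_bounded compact_continuous_image) auto
  then show ?thesis
    using U unfolding bounded_iff by (auto simp: to_ell2)
qed

text \<open>Two given solutions are each bounded, being continuous on a compact interval, so
  stability applies on the larger of the two balls. Uniqueness thus holds among all continuous
  solutions, not only those in the Picard ball.\<close>

lemma mild_unique:
  assumes T: "T \<le> Ts" and U0: "U0 \<in> Xs s" and f: "L1 s Ts f"
    and U: "mild p s T U0 f U" and V: "mild p s T U0 f V" and t: "t \<in> {0..T}"
  shows "U t = V t"
proof -
  obtain R1 R2 where R: "\<forall>t\<in>{0..T}. Xnorm s (U t) \<le> R1" "\<forall>t\<in>{0..T}. Xnorm s (V t) \<le> R2"
    using mild_bounded[OF U] mild_bounded[OF V] by blast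
  obtain K where K: "0 \<le> K" "\<And>x y. norm x \<le> max R1 R2 \<Longrightarrow> norm y \<le> max R1 R2 \<Longrightarrow>
      norm (nonlin p s x - nonlin p s y) \<le> K * norm (x - y)"
    using lipschitz_on_bounded_nonlin[OF s ps] unfolding lipschitz_on_bounded_def by metis
  have "L1norm s Ts (fdiff f f) = 0"
    by (simp add: L1norm_def fdiff_def Hnorm_def set_lebesgue_integral_def)
  moreover have "Xnorm s (stdiff U0 U0) = 0"
    by (simp add: Xnorm_stdiff U0)
  ultimately have "Xnorm s (stdiff (U t) (V t)) \<le> 0"
    using mild_stability[where R = "max R1 R2", OF K T U0 f U _ U0 f V _ t] R by (simp add: le_max_iff_disj)
  moreover have X: "U t \<in> Xs s" "V t \<in> Xs s"
    using U V t by (auto simp: mild_def Cpath_iff)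
  ultimately have "of_ell2 s (to_ell2 s (U t)) = of_ell2 s (to_ell2 s (V t))"
    by (simp add: Xnorm_stdiff)
  then show ?thesis
    by (simp only: of_ell2_to_ell2[OF X(1)] of_ell2_to_ell2[OF X(2)])
qed

lemma mild_exists:
  assumes T: "0 \<le> T" "T \<le> Ts" and U0: "U0 \<in> Xs s" and f: "L1 s Ts f"
    and m: "Xnorm s U0 + L1norm s Ts f \<le> m"
    and K: "0 \<le> K" "\<And>x y. norm x \<le> m + 1 \<Longrightarrow> norm y \<le> m + 1 \<Longrightarrow>
      norm (nonlin p s x - nonlin p s y) \<le> K * norm (x - y)"
    and small: "T * K * (m + 1) \<le> 1 / 2"
  obtains U where "mild p s T U0 f U" "\<And>t. t \<in> {0..T} \<Longrightarrow> Xnorm s (U t) \<le> m + 1"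
proof -
  have lip: "norm (twisted p s t x - twisted p s t y) \<le> K * norm (x - y)"
    if "norm x \<le> m + 1" "norm y \<le> m + 1" for t x y
    using K(2)[of "propagator t x" "propagator t y"] that
    by (intro norm_twisted_diff_le) (simp flip: propagator_diff)
  have b_cont: "continuous_on {0..T} (duhamel_data s U0 f)"
    by (rule continuous_on_duhamel_data[OF f T(2)])
  have b_le: "norm (duhamel_data s U0 f t) \<le> m" if t: "t \<in> {0..T}" for t
  proof -
    have "norm (duhamel_data s U0 f t) \<le> Xnorm s U0 + L1norm s Ts f"
      unfolding duhamel_data_def
      by (rule order.trans[OF norm_triangle_ineq], intro add_mono norm_forcing_integral_le f)
         (use t T in \<open>auto simp: to_ell2 U0\<close>)
    with m show ?thesis by simp
  qed
  have M0: "twisted p s t 0 = 0" for t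
    by (simp add: twisted_def nonlin_0[OF s] linear_0[OF bounded_linear.linear[OF bounded_linear_propagator]])
  obtain y where y: "continuous_on {0..T} y" "\<And>t. t \<in> {0..T} \<Longrightarrow> norm (y t) \<le> m + 1"
    "\<And>t. t \<in> {0..T} \<Longrightarrow> y t = duhamel_data s U0 f t + integral {0..t} (\<lambda>r. twisted p s r (y r))"
    using integral_equation_solvable[of T K "duhamel_data s U0 f" m "twisted p s",
      OF T(1) K(1) b_cont b_le continuous_on_twisted lip M0 small] by blast
  have conj: "conj_ell2 (y t) = y t" if t: "t \<in> {0..T}" for t
  proof -
    have yc: "continuous_on {0..T} (\<lambda>t. conj_ell2 (y t))"
      by (rule bounded_linear.continuous_on[OF bounded_linear_conj_ell2 y(1)])
    have lin: "linear conj_ell2"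
      by (rule bounded_linear.linear[OF bounded_linear_conj_ell2])
    have tw: "conj_ell2 (twisted p s r x) = twisted p s r (conj_ell2 x)" for r x
      by (simp add: twisted_def linear_neg[OF lin] conj_ell2_propagator conj_ell2_nonlin[OF s p ps])
    \<comment> \<open>The conjugate of \<open>y\<close> lies in the same ball and solves the same
      equation with the same real data, so the stability estimate applies with data distance
      0.\<close>
    have "norm (conj_ell2 (y t) - y t) \<le> 2 * 0 * exp (2 * K * T)"
    proof (rule integral_equation_stability[where M = "twisted p s" and ?b1.0 = "duhamel_data s U0 f"
          and ?b2.0 = "duhamel_data s U0 f", OF K(1) yc y(1) _ _ _ _ y(3) _ t])
      show "continuous_on {0..T} (\<lambda>t. twisted p s t (conj_ell2 (y t)))"
        "continuous_on {0..T} (\<lambda>t. twisted p s t (y t))"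
        by (intro continuous_on_twisted yc y(1))+
      fix r assume r: "r \<in> {0..T}"
      show "norm (twisted p s r (conj_ell2 (y r)) - twisted p s r (y r)) \<le> K * norm (conj_ell2 (y r) - y r)"
        by (intro lip order.trans[OF conj_ell2(2)] y(2) r)
      have int: "(\<lambda>r. twisted p s r (y r)) integrable_on {0..r}"
        by (rule integrable_continuous_interval, rule continuous_on_subset[OF continuous_on_twisted[OF y(1)]])
           (use r in auto)
      have "conj_ell2 (duhamel_data s U0 f r) = duhamel_data s U0 f r"
        using r T by (simp add: duhamel_data_def linear_add[OF lin] conj_ell2_to_ell2[OF U0] conj_forcing_integral[OF f])
      then show "conj_ell2 (y r) = duhamel_data s U0 f r + integral {0..r} (\<lambda>r. twisted p s r (conj_ell2 (y r)))"
        using integral_linear[OF int bounded_linear_conj_ell2]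
        by (subst y(3)[OF r]) (simp add: linear_add[OF lin] o_def tw)
    qed auto
    then show ?thesis by simp
  qed
  define U where "U t = of_ell2 s (propagator t (y t))" for t
  have UX: "U t \<in> Xs s" "to_ell2 s (U t) = propagator t (y t)" if "t \<in> {0..T}" for t
    using of_ell2_Xs[of "propagator t (y t)" s] conj[OF that] by (simp_all add: U_def conj_ell2_propagator)
  have prof: "profile s U t = y t" if "t \<in> {0..T}" for t
    by (simp add: profile_def UX(2)[OF that] propagator_propagator)
  show thesis
  proof (rule that)
    have "continuous_on {0..T} (\<lambda>t. propagator t (y t))"
      by (intro continuous_on_propagator y(1) continuous_on_id)
    then have "continuous_on {0..T} (\<lambda>t. to_ell2 s (U t))"
      by (rule continuous_on_eq) (simp add: UX(2))
    moreover have "profile s U t = duhamel_data s U0 f t + integral {0..t} (\<lambda>r. twisted p s r (profile s U r))"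
      if t: "t \<in> {0..T}" for t
    proof -
      have "integral {0..t} (\<lambda>r. twisted p s r (profile s U r)) = integral {0..t} (\<lambda>r. twisted p s r (y r))"
        by (rule integral_cong) (use t prof in auto)
      then show ?thesis
        using y(3)[OF t] prof[OF t] by simp
    qed
    ultimately show "mild p s T U0 f U"
      unfolding mild_iff[OF U0 f T(2)] using UX(1) by blast
    show "Xnorm s (U t) \<le> m + 1" if "t \<in> {0..T}" for t
      using y(2)[OF that] norm_profile[of U t s, OF UX(1)[OF that]] prof[OF that] by simp
  qed
qed

end

lemma Xnorm_le_add_stdiff:
  assumes "U \<in> Xs s" "V \<in> Xs s"
  shows "Xnorm s V \<le> Xnorm s U + Xnorm s (stdiff V U)"
  using norm_triangle_sub[of "to_ell2 s V" "to_ell2 s U"] assms by (simp add: Xnorm_stdiff to_ell2)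

text \<open>Quantifying \<open>Tf\<close> before the data expresses that the existence time depends
  on the two norms alone. The Lipschitz clause concerns arbitrary mild solutions, so their bounds
  must come from uniqueness.\<close>

theorem theorem2p3:
  fixes Ts s :: real and p :: nat
  assumes "Ts > 0" and "p \<ge> 1"
    and "(p = 1 \<and> s \<ge> 0) \<or> (p > 1 \<and> s > 1/2)"
  shows "\<exists>Tf :: real \<Rightarrow> real \<Rightarrow> real. \<forall>U0 f. U0 \<in> Xs s \<and> L1 s Ts f \<longrightarrow>
    (let T = Tf (Xnorm s U0) (L1norm s Ts f) in
       0 < T \<and> T \<le> Ts \<and>
       (\<exists>U. mild p s T U0 f U \<and> (\<forall>U'. mild p s T U0 f U' \<longrightarrow> (\<forall>t\<in>{0..T}. U' t = U t))) \<and>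
       (\<forall>T1. 0 < T1 \<and> T1 < T \<longrightarrow>
          (\<exists>\<delta>>0. \<exists>L::real.
             (\<forall>V0 g. V0 \<in> Xs s \<and> L1 s Ts g \<and>
                 Xnorm s (stdiff V0 U0) + L1norm s Ts (fdiff g f) < \<delta> \<longrightarrow>
                 (\<exists>V. mild p s T1 V0 g V)) \<and>
             (\<forall>V0 g W0 h V W.
                 V0 \<in> Xs s \<and> L1 s Ts g \<and> Xnorm s (stdiff V0 U0) + L1norm s Ts (fdiff g f) < \<delta> \<and>
                 W0 \<in> Xs s \<and> L1 s Ts h \<and> Xnorm s (stdiff W0 U0) + L1norm s Ts (fdiff h f) < \<delta> \<and>
                 mild p s T1 V0 g V \<and> mild p s T1 W0 h W \<longrightarrow>
                 (\<forall>t\<in>{0..T1}. Xnorm s (stdiff (V t) (W t))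
                     \<le> L * (Xnorm s (stdiff V0 W0) + L1norm s Ts (fdiff g h)))))))"
proof -
  have s: "0 \<le> s" and ps: "p = 1 \<or> s > 1/2" and p: "p \<ge> 1"
    using assms by auto
  obtain K where K: "\<And>R. 0 \<le> K R" "\<And>R x y. norm x \<le> R \<Longrightarrow> norm y \<le> R \<Longrightarrow>
      norm (nonlin p s x - nonlin p s y) \<le> K R * norm (x - y)"
    using lipschitz_on_bounded_nonlin[OF s ps] unfolding lipschitz_on_bounded_def by metis
  \<comment> \<open>The existence time for data of norm at most \<open>a + b + 1\<close>, so that it serves the unit
    neighbourhood of the given data as well.\<close>
  define Tf where "Tf a b = min Ts (1 / (2 * (K (a + b + 2) + 1) * (a + b + 2)))" for a b :: real
  show ?thesis
  proof (intro exI[of _ Tf] allI impI, elim conjE)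
    fix U0 f assume U0: "U0 \<in> Xs s" and f: "L1 s Ts f"
    \<comment> \<open>Bounds all data in the unit neighbourhood; the Picard ball then has radius
      \<open>m + 1\<close>, the \<open>a + b + 2\<close> of \<open>Tf\<close>.\<close>
    define m where "m = Xnorm s U0 + L1norm s Ts f + 1"
    define T where "T = Tf (Xnorm s U0) (L1norm s Ts f)"
    have m: "1 \<le> m"
    proof -
      have "0 \<le> L1norm s Ts f"
        by (rule order.trans[OF norm_ge_zero norm_forcing_integral_le[OF f, of 0]]) (use assms(1) in simp)
      moreover have "0 \<le> Xnorm s U0"
        by (simp add: Xnorm_def)
      ultimately show ?thesis
        by (simp add: m_def)
    qed
    have T_def': "T = min Ts (1 / (2 * (K (m + 1) + 1) * (m + 1)))"
      unfolding T_def Tf_def m_def by (simp add: add_ac)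
    \<comment> \<open>The 1 added to \<open>K\<close> keeps the denominator positive when the
      Lipschitz constant is 0.\<close>
    have den: "0 < 2 * (K (m + 1) + 1) * (m + 1)"
      using K(1)[of "m + 1"] m by (intro mult_pos_pos) auto
    have T: "0 < T" "T \<le> Ts"
      unfolding T_def' using assms(1) den by auto
    have small: "t * K (m + 1) * (m + 1) \<le> 1 / 2" if "0 \<le> t" "t \<le> T" for t
    proof -
      have "t * (2 * (K (m + 1) + 1) * (m + 1)) \<le> 1"
        using that den unfolding T_def' by (simp add: pos_le_divide_eq)
      moreover have "0 \<le> t * (m + 1)"
        using that m by simp
      ultimately show ?thesis
        by (simp add: algebra_simps)
    qed
    have ex: "\<exists>V. mild p s t V0 g V \<and> (\<forall>r\<in>{0..t}. Xnorm s (V r) \<le> m + 1)"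
      if t: "0 \<le> t" "t \<le> T" and V0: "V0 \<in> Xs s" and g: "L1 s Ts g"
        and d: "Xnorm s (stdiff V0 U0) + L1norm s Ts (fdiff g f) < 1" for t V0 g
    proof -
      have le: "Xnorm s V0 + L1norm s Ts g \<le> m"
        using Xnorm_le_add_stdiff[OF U0 V0] L1norm_le_add_fdiff[OF g f] d by (simp add: m_def)
      show ?thesis
      proof (rule mild_exists[OF s p ps t(1) order.trans[OF t(2) T(2)] V0 g le K(1) _ small[OF t]])
        show "norm (nonlin p s x - nonlin p s y) \<le> K (m + 1) * norm (x - y)"
          if "norm x \<le> m + 1" "norm y \<le> m + 1" for x y
          using that by (rule K(2))
      qed blast
    qed
    \<comment> \<open>An arbitrary mild solution coincides with the one constructed in
      \<open>ex\<close> and inherits its bound; this makes the Lipschitz constant below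
      uniform.\<close>
    have bounded: "Xnorm s (V r) \<le> m + 1"
      if t: "0 \<le> t" "t \<le> T" and V0: "V0 \<in> Xs s" and g: "L1 s Ts g"
        and d: "Xnorm s (stdiff V0 U0) + L1norm s Ts (fdiff g f) < 1"
        and V: "mild p s t V0 g V" and r: "r \<in> {0..t}" for t V0 g V r
    proof -
      obtain V' where V': "mild p s t V0 g V'" "\<forall>r\<in>{0..t}. Xnorm s (V' r) \<le> m + 1"
        using ex[OF t V0 g d] by blast
      have "V r = V' r"
        using t T by (intro mild_unique[OF s p ps _ V0 g V V'(1) r]) simp
      with V'(2) r show ?thesis by simp
    qed
    have "Xnorm s (stdiff U0 U0) + L1norm s Ts (fdiff f f) = 0"
      by (simp add: Xnorm_stdiff U0 L1norm_def fdiff_def Hnorm_def set_lebesgue_integral_def)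
    then obtain U where U: "mild p s T U0 f U"
      using ex[of T U0 f] U0 f T by auto
    have "\<exists>\<delta>>0. \<exists>L::real.
             (\<forall>V0 g. V0 \<in> Xs s \<and> L1 s Ts g \<and>
                 Xnorm s (stdiff V0 U0) + L1norm s Ts (fdiff g f) < \<delta> \<longrightarrow>
                 (\<exists>V. mild p s T1 V0 g V)) \<and>
             (\<forall>V0 g W0 h V W.
                 V0 \<in> Xs s \<and> L1 s Ts g \<and> Xnorm s (stdiff V0 U0) + L1norm s Ts (fdiff g f) < \<delta> \<and>
                 W0 \<in> Xs s \<and> L1 s Ts h \<and> Xnorm s (stdiff W0 U0) + L1norm s Ts (fdiff h f) < \<delta> \<and>
                 mild p s T1 V0 g V \<and> mild p s T1 W0 h W \<longrightarrow>
                 (\<forall>t\<in>{0..T1}. Xnorm s (stdiff (V t) (W t))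
                     \<le> L * (Xnorm s (stdiff V0 W0) + L1norm s Ts (fdiff g h))))"
      if T1: "0 < T1" "T1 < T" for T1
    \<comment> \<open>The neighbourhood is the unit one already accounted for in \<open>m\<close>,
      and \<open>L\<close> is the factor of \<open>mild_stability\<close> for the ball of radius
      \<open>m + 1\<close>.\<close>
    proof (rule exI[of _ 1], rule conjI[OF zero_less_one], rule exI[of _ "2 * exp (2 * K (m + 1) * T1)"],
        intro conjI allI impI ballI; elim conjE)
      show "\<exists>V. mild p s T1 V0 g V" if "V0 \<in> Xs s" "L1 s Ts g"
        "Xnorm s (stdiff V0 U0) + L1norm s Ts (fdiff g f) < 1" for V0 g
        using ex[of T1 V0 g] that T1 by auto
      fix V0 g W0 h V W t
      assume V: "V0 \<in> Xs s" "L1 s Ts g" "mild p s T1 V0 g V"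
        and W: "W0 \<in> Xs s" "L1 s Ts h" "mild p s T1 W0 h W"
        and dV: "Xnorm s (stdiff V0 U0) + L1norm s Ts (fdiff g f) < 1"
        and dW: "Xnorm s (stdiff W0 U0) + L1norm s Ts (fdiff h f) < 1"
        and t: "t \<in> {0..T1}"
      have T1': "0 \<le> T1" "T1 \<le> T" "T1 \<le> Ts"
        using T1 T by auto
      show "Xnorm s (stdiff (V t) (W t))
          \<le> 2 * exp (2 * K (m + 1) * T1) * (Xnorm s (stdiff V0 W0) + L1norm s Ts (fdiff g h))"
      proof (rule mild_stability[OF s p ps K(1) _ T1'(3) V _ W _ t])
        show "norm (nonlin p s x - nonlin p s y) \<le> K (m + 1) * norm (x - y)"
          if "norm x \<le> m + 1" "norm y \<le> m + 1" for x y
          using that by (rule K(2))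
        show "Xnorm s (V r) \<le> m + 1" "Xnorm s (W r) \<le> m + 1" if "r \<in> {0..T1}" for r
          using bounded[OF T1'(1,2) V(1,2) dV V(3) that] bounded[OF T1'(1,2) W(1,2) dW W(3) that] by auto
      qed
    qed
    moreover have "\<forall>U'. mild p s T U0 f U' \<longrightarrow> (\<forall>t\<in>{0..T}. U' t = U t)"
      using mild_unique[OF s p ps T(2) U0 f _ U] by blast
    ultimately show "let T = Tf (Xnorm s U0) (L1norm s Ts f) in
       0 < T \<and> T \<le> Ts \<and>
       (\<exists>U. mild p s T U0 f U \<and> (\<forall>U'. mild p s T U0 f U' \<longrightarrow> (\<forall>t\<in>{0..T}. U' t = U t))) \<and>
       (\<forall>T1. 0 < T1 \<and> T1 < T \<longrightarrow>
          (\<exists>\<delta>>0. \<exists>L::real.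
             (\<forall>V0 g. V0 \<in> Xs s \<and> L1 s Ts g \<and>
                 Xnorm s (stdiff V0 U0) + L1norm s Ts (fdiff g f) < \<delta> \<longrightarrow>
                 (\<exists>V. mild p s T1 V0 g V)) \<and>
             (\<forall>V0 g W0 h V W.
                 V0 \<in> Xs s \<and> L1 s Ts g \<and> Xnorm s (stdiff V0 U0) + L1norm s Ts (fdiff g f) < \<delta> \<and>
                 W0 \<in> Xs s \<and> L1 s Ts h \<and> Xnorm s (stdiff W0 U0) + L1norm s Ts (fdiff h f) < \<delta> \<and>
                 mild p s T1 V0 g V \<and> mild p s T1 W0 h W \<longrightarrow>
                 (\<forall>t\<in>{0..T1}. Xnorm s (stdiff (V t) (W t))
                     \<le> L * (Xnorm s (stdiff V0 W0) + L1norm s Ts (fdiff g h))))))"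
      unfolding Let_def T_def[symmetric] using T U by blast
  qed
qed

end
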